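(* Let $G$ be a profinite group which has alternating composition factors of unbounded degree, i.e. for every $N$ there is $k\ge N$ such that the alternating group $A_k$ is a composition factor of some finite continuous quotient of $G$. Then for every $n\ge1$, almost every $n$-tuple of elements of $G$ (with respect to the product of the normalized Haar measure) generates a free subgroup.
   Context: A profinite group carries a unique invariant probability (Haar) measure; "almost every" means outside a set of measure zero in $G^n$. The composition factors of a profinite group $G$ are the composition factors of its finite quotients $G/N$ with $N$ open normal. *)

theory Defs
  imports "HOL-Analysis.Analysis" "HOL-Probability.Probability" "HOL-Algebra.Algebra"
begin

definition topological_group :: "('a, 'b) monoid_scheme \<Rightarrow> 'a topology \<Rightarrow> bool" where
  "topological_group G T \<longleftrightarrow>
     group G \<and> topspace T = carrier G \<and>
     continuous_map (prod_topology T T) T (\<lambda>(x, y). x \<otimes>\<^bsub>G\<^esub> y) \<and>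
     continuous_map T T (\<lambda>x. inv\<^bsub>G\<^esub> x)"

definition totally_disconnected_space :: "'a topology \<Rightarrow> bool" where
  "totally_disconnected_space T \<longleftrightarrow>
     (\<forall>S. connectedin T S \<longrightarrow> (\<forall>x\<in>S. \<forall>y\<in>S. x = y))"

definition profinite_group :: "('a, 'b) monoid_scheme \<Rightarrow> 'a topology \<Rightarrow> bool" where
  "profinite_group G T \<longleftrightarrow>
     topological_group G T \<and> compact_space T \<and> Hausdorff_space T \<and>
     totally_disconnected_space T"

definition power_group :: "nat \<Rightarrow> ('a, 'b) monoid_scheme \<Rightarrow> (nat \<Rightarrow> 'a) monoid" where
  "power_group n G =
     \<lparr> carrier = PiE {..<n} (\<lambda>_. carrier G),
       mult = (\<lambda>x y. \<lambda>i\<in>{..<n}. x i \<otimes>\<^bsub>G\<^esub> y i),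
       one = (\<lambda>i\<in>{..<n}. \<one>\<^bsub>G\<^esub>) \<rparr>"

definition borel_sets_of :: "'a topology \<Rightarrow> 'a set set" where
  "borel_sets_of T = sigma_sets (topspace T) {U. openin T U}"

text \<open>Normalized (left) Haar measure of a compact group: a left-invariant regular Borel
  probability measure (outer regular on Borel sets, inner regular by compact sets on open
  sets).  For compact Hausdorff groups it is unique.\<close>

definition haar_measure :: "'a topology \<Rightarrow> ('a, 'b) monoid_scheme \<Rightarrow> 'a measure \<Rightarrow> bool" where
  "haar_measure T G \<mu> \<longleftrightarrow>
     prob_space \<mu> \<and> space \<mu> = topspace T \<and> sets \<mu> = borel_sets_of T \<and>
     (\<forall>g\<in>carrier G. \<forall>A\<in>sets \<mu>.
        (\<lambda>x. g \<otimes>\<^bsub>G\<^esub> x) ` A \<in> sets \<mu> \<and>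
        emeasure \<mu> ((\<lambda>x. g \<otimes>\<^bsub>G\<^esub> x) ` A) = emeasure \<mu> A) \<and>
     (\<forall>A\<in>sets \<mu>. emeasure \<mu> A = (INF U\<in>{U. openin T U \<and> A \<subseteq> U}. emeasure \<mu> U)) \<and>
     (\<forall>U. openin T U \<longrightarrow>
        emeasure \<mu> U = (SUP K\<in>{K. compactin T K \<and> K \<subseteq> U}. emeasure \<mu> K))"

definition composition_series :: "('a, 'b) monoid_scheme \<Rightarrow> 'a set list \<Rightarrow> bool" where
  "composition_series H L \<longleftrightarrow>
     L \<noteq> [] \<and> hd L = carrier H \<and> last L = {\<one>\<^bsub>H\<^esub>} \<and>
     (\<forall>i < length L - 1.
        L ! Suc i \<lhd> H\<lparr>carrier := L ! i\<rparr> \<and>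
        simple_group (H\<lparr>carrier := L ! i\<rparr> Mod (L ! Suc i)))"

definition composition_factor :: "('a, 'b) monoid_scheme \<Rightarrow> ('c, 'd) monoid_scheme \<Rightarrow> bool" where
  "composition_factor H S \<longleftrightarrow>
     (\<exists>L. composition_series H L \<and>
        (\<exists>i < length L - 1. (H\<lparr>carrier := L ! i\<rparr> Mod (L ! Suc i)) \<cong> S))"

fun reduced_word :: "(nat \<times> bool) list \<Rightarrow> bool" where
  "reduced_word [] = True"
| "reduced_word [_] = True"
| "reduced_word ((i, b) # (j, c) # w) \<longleftrightarrow>
     \<not> (i = j \<and> b \<noteq> c) \<and> reduced_word ((j, c) # w)"

fun eval_word :: "('a, 'b) monoid_scheme \<Rightarrow> (nat \<Rightarrow> 'a) \<Rightarrow> (nat \<times> bool) list \<Rightarrow> 'a" where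
  "eval_word G x [] = \<one>\<^bsub>G\<^esub>"
| "eval_word G x ((i, b) # w) =
     (if b then x i else inv\<^bsub>G\<^esub> (x i)) \<otimes>\<^bsub>G\<^esub> eval_word G x w"

definition freely_generates :: "('a, 'b) monoid_scheme \<Rightarrow> nat \<Rightarrow> (nat \<Rightarrow> 'a) \<Rightarrow> bool" where
  "freely_generates G n x \<longleftrightarrow>
     (\<forall>i<n. x i \<in> carrier G) \<and>
     (\<forall>w. w \<noteq> [] \<and> reduced_word w \<and> (\<forall>(i, b)\<in>set w. i < n) \<longrightarrow>
        eval_word G x w \<noteq> \<one>\<^bsub>G\<^esub>)"

end

(* Let H be a finite quotient of G with composition factor Alt(k).  Then some normal subgroup N of H
   maps onto Alt(k), and with P the preimage in N of a point stabilizer, every N-orbit on the coset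
   space H/P is a copy of the natural action of Alt(k) on k points, twisted by conjugation in H.  No
   knowledge of the automorphisms of Alt(k) is needed: comparing indices shows that if F is a set of
   r points, s is fixed and k is large, then on each N-orbit at most r points have an orbit of
   size < s under the pointwise stabilizer of F in N.

   Follow a point through the letters of a reduced word w of length l, evaluated at a uniformly
   random tuple of H.  Given the part of the walk already seen, the next point is uniform on a set of
   at least s points inside one N-orbit, so it is exceptional for the next step with probability
   at most l/s; as visited points are exceptional, the walk closes up, and hence w = 1 holds, with
   probability at most l^2/s.  Haar measure on G^n projects to the uniform measure on H^n, so w = 1
   has measure zero in G^n, and there are only countably many words. *)
theory Submission
  imports Defs
begin

section \<open>Actions whose orbits look like the alternating group on k points\<close>

text \<open>Letters take values in \<open>H\<close>, not in \<open>N\<close>, so the walk jumps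
  between \<open>N\<close>-orbits, and the actions of \<open>N\<close> on two orbits may be
  correlated: fixing a point of one may fix points of the other. Lower bounds for stabilizer indices
  are therefore available only inside one orbit, where \<open>three_cycle\<close> controls a
  permutation; what it does elsewhere is left open. The comparison of indices avoids mixed lower
  bounds. Fixing \<open>F\<close>, wherever its \<open>r\<close> points lie, costs at most
  \<open>k ^ r\<close>; fixing \<open>r + 1\<close> points of a single orbit costs about
  \<open>k ^ (r + 1)\<close>. The missing factor of order \<open>k\<close> cannot be made up by
  \<open>r + 1\<close> factors of at most \<open>s\<close> once \<open>k\<close> is large against a
  power of \<open>s\<close>. So the word and \<open>s\<close> are fixed first, then
  \<open>k\<close>, and only at the end does \<open>s\<close> tend to infinity. The second obstacle
  is that a composition series gives just subnormal subgroups, whereas \<open>N\<close> must be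
  normal for elements of \<open>H\<close> to map \<open>N\<close>-orbits to \<open>N\<close>-orbits.
  A minimality argument on normal subgroups closes this gap without the structure theory of chief
  factors.\<close>

locale alternating_action = group H for H (structure) +
  fixes N :: "'a set" and \<Omega> :: "'p set" and act :: "'a \<Rightarrow> 'p \<Rightarrow> 'p" and k :: nat
  assumes finite_carrier: "finite (carrier H)"
    and normal_N: "N \<lhd> H"
    and act_closed: "\<And>x p. x \<in> carrier H \<Longrightarrow> p \<in> \<Omega> \<Longrightarrow> act x p \<in> \<Omega>"
    and act_mult: "\<And>x y p. x \<in> carrier H \<Longrightarrow> y \<in> carrier H \<Longrightarrow> p \<in> \<Omega> \<Longrightarrow>
      act (x \<otimes> y) p = act x (act y p)"
    and act_one: "\<And>p. p \<in> \<Omega> \<Longrightarrow> act \<one> p = p"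
    and card_orbit: "\<And>p. p \<in> \<Omega> \<Longrightarrow> card ((\<lambda>n. act n p) ` N) = k"
    and three_cycle: "\<And>p q r. \<lbrakk>p \<in> \<Omega>; q \<in> (\<lambda>n. act n p) ` N; r \<in> (\<lambda>n. act n p) ` N;
      p \<noteq> q; q \<noteq> r; p \<noteq> r\<rbrakk> \<Longrightarrow>
      \<exists>d\<in>N. act d p = q \<and> (\<forall>z\<in>(\<lambda>n. act n p) ` N. z \<notin> {p, q, r} \<longrightarrow> act d z = z)"
begin

lemma N_carrier: "x \<in> N \<Longrightarrow> x \<in> carrier H"
  using normal_imp_subgroup[OF normal_N] subgroup.subset by blast

lemma N_mult: "x \<in> N \<Longrightarrow> y \<in> N \<Longrightarrow> x \<otimes> y \<in> N"
  using normal_imp_subgroup[OF normal_N] by (rule subgroup.m_closed)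

lemma N_inv: "x \<in> N \<Longrightarrow> inv x \<in> N"
  using normal_imp_subgroup[OF normal_N] by (rule subgroup.m_inv_closed)

lemma N_one: "\<one> \<in> N"
  using normal_imp_subgroup[OF normal_N] by (rule subgroup.one_closed)

lemma finite_N: "finite N"
  using finite_carrier N_carrier by (meson finite_subset subsetI)

lemma act_inv_act: "x \<in> carrier H \<Longrightarrow> p \<in> \<Omega> \<Longrightarrow> act (inv x) (act x p) = p"
  by (metis act_mult act_one inv_closed l_inv)

section \<open>Pointwise stabilizers in \<open>N\<close> and their orbits\<close>

definition pstab :: "'p set \<Rightarrow> 'a set" where
  "pstab U = {n \<in> N. \<forall>x\<in>U. act n x = x}"

definition orb :: "'p set \<Rightarrow> 'p \<Rightarrow> 'p set" where
  "orb U p = (\<lambda>n. act n p) ` pstab U"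

lemma pstab_subset: "pstab U \<subseteq> N"
  by (auto simp: pstab_def)

lemma finite_pstab: "finite (pstab U)"
  using pstab_subset finite_N finite_subset by blast

lemma pstab_carrier: "d \<in> pstab U \<Longrightarrow> d \<in> carrier H"
  using pstab_subset N_carrier by blast

lemma pstab_antimono: "U \<subseteq> Y \<Longrightarrow> pstab Y \<subseteq> pstab U"
  by (auto simp: pstab_def)

lemma pstab_empty: "pstab {} = N"
  by (auto simp: pstab_def)

lemma one_pstab: "U \<subseteq> \<Omega> \<Longrightarrow> \<one> \<in> pstab U"
  by (auto simp: pstab_def N_one act_one)

lemma card_pstab_pos: "U \<subseteq> \<Omega> \<Longrightarrow> card (pstab U) > 0"
  using one_pstab finite_pstab card_gt_0_iff by blast

lemma pstab_mult: "U \<subseteq> \<Omega> \<Longrightarrow> d \<in> pstab U \<Longrightarrow> e \<in> pstab U \<Longrightarrow> d \<otimes> e \<in> pstab U"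
  unfolding pstab_def by (auto simp: N_mult act_mult N_carrier subset_iff)

lemma pstab_inv: "U \<subseteq> \<Omega> \<Longrightarrow> d \<in> pstab U \<Longrightarrow> inv d \<in> pstab U"
proof -
  assume U: "U \<subseteq> \<Omega>" and d: "d \<in> pstab U"
  have "act (inv d) x = x" if "x \<in> U" for x
  proof -
    have "act d x = x" using d that by (simp add: pstab_def)
    then show ?thesis using act_inv_act[OF pstab_carrier[OF d], of x] that U by auto
  qed
  moreover have "inv d \<in> N" using d pstab_subset N_inv by blast
  ultimately show "inv d \<in> pstab U" by (simp add: pstab_def)
qed

lemma finite_orb: "finite (orb U p)"
  by (simp add: orb_def finite_pstab)

text \<open>The elements counted form a left coset of \<open>pstab (insert p U)\<close>, namely its
  translate by any one of them.\<close>

lemma card_pstab_fiber: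
  assumes U: "U \<subseteq> \<Omega>" and p: "p \<in> \<Omega>" and q: "q \<in> orb U p"
  shows "card {d \<in> pstab U. act d p = q} = card (pstab (insert p U))"
proof -
  obtain e where e: "e \<in> pstab U" "act e p = q"
    using q by (auto simp: orb_def)
  have ec: "e \<in> carrier H" using e pstab_carrier by blast
  have "bij_betw (\<lambda>d. e \<otimes> d) (pstab (insert p U)) {d \<in> pstab U. act d p = q}"
  proof (rule bij_betw_byWitness[where f' = "\<lambda>d. inv e \<otimes> d"])
    show "\<forall>a\<in>pstab (insert p U). inv e \<otimes> (e \<otimes> a) = a"
      using ec pstab_carrier by (auto simp: m_assoc[symmetric])
    show "\<forall>a'\<in>{d \<in> pstab U. act d p = q}. e \<otimes> (inv e \<otimes> a') = a'"
      using ec pstab_carrier by (auto simp: m_assoc[symmetric])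
    show "(\<otimes>) e ` pstab (insert p U) \<subseteq> {d \<in> pstab U. act d p = q}"
    proof (safe)
      fix d assume d: "d \<in> pstab (insert p U)"
      then have dX: "d \<in> pstab U" using pstab_antimono by blast
      show "e \<otimes> d \<in> pstab U" using pstab_mult[OF U e(1) dX] .
      show "act (e \<otimes> d) p = q"
        using d e ec pstab_carrier[OF d] p by (simp add: act_mult) (simp add: pstab_def)
    qed
    show "(\<otimes>) (inv e) ` {d \<in> pstab U. act d p = q} \<subseteq> pstab (insert p U)"
    proof (safe)
      fix d assume d: "d \<in> pstab U" "q = act d p"
      have "inv e \<otimes> d \<in> pstab U" using pstab_mult[OF U pstab_inv[OF U e(1)] d(1)] .
      moreover have "act (inv e \<otimes> d) p = p"
        using d e ec pstab_carrier[OF d(1)] p act_inv_act[OF ec p] by (simp add: act_mult)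
      ultimately show "inv e \<otimes> d \<in> pstab (insert p U)"
        by (auto simp: pstab_def)
    qed
  qed
  then show ?thesis by (simp add: bij_betw_same_card)
qed

text \<open>Orbit-stabilizer for one more fixed point; all index estimates iterate this
  identity.\<close>

lemma card_pstab_orb:
  assumes U: "U \<subseteq> \<Omega>" and p: "p \<in> \<Omega>"
  shows "card (pstab U) = card (orb U p) * card (pstab (insert p U))"
proof -
  have "card (pstab U) = (\<Sum>q\<in>orb U p. card {d \<in> pstab U. act d p = q})"
    using sum.image_gen[OF finite_pstab, of "\<lambda>_. 1::nat" U "\<lambda>n. act n p"] by (simp add: orb_def)
  also have "\<dots> = (\<Sum>q\<in>orb U p. card (pstab (insert p U)))"
    using card_pstab_fiber[OF U p] by simp
  finally show ?thesis by simp
qed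

lemma card_orb_le:
  assumes "p \<in> \<Omega>"
  shows "card (orb U p) \<le> k"
proof -
  have "orb U p \<subseteq> (\<lambda>n. act n p) ` N"
    using pstab_subset by (auto simp: orb_def)
  then show ?thesis
    using card_mono[OF finite_imageI[OF finite_N]] card_orbit[OF assms] by metis
qed

text \<open>Each further fixed point costs a factor of at most \<open>k\<close>, whichever
  \<open>N\<close>-orbit it comes from.\<close>

lemma card_N_le:
  assumes "finite U" "U \<subseteq> \<Omega>"
  shows "card N \<le> k ^ card U * card (pstab U)"
  using assms
proof (induction U rule: finite_induct)
  case empty
  then show ?case by (simp add: pstab_empty)
next
  case (insert p U)
  then have U: "U \<subseteq> \<Omega>" and p: "p \<in> \<Omega>" by auto
  have "card N \<le> k ^ card U * (card (orb U p) * card (pstab (insert p U)))"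
    using insert.IH[OF U] card_pstab_orb[OF U p] by simp
  also have "\<dots> \<le> k ^ card U * (k * card (pstab (insert p U)))"
    using card_orb_le[OF p] by simp
  finally show ?case using insert.hyps by (simp add: ac_simps)
qed

lemma orbit_closed: "p \<in> \<Omega> \<Longrightarrow> (\<lambda>n. act n p) ` N \<subseteq> \<Omega>"
  using act_closed N_carrier by blast

lemma orbit_eq:
  assumes p: "p \<in> \<Omega>" and q: "q \<in> (\<lambda>n. act n p) ` N"
  shows "(\<lambda>n. act n q) ` N = (\<lambda>n. act n p) ` N"
proof -
  obtain m where m: "m \<in> N" "q = act m p" using q by blast
  show ?thesis
  proof (safe)
    fix n assume n: "n \<in> N"
    show "act n q \<in> (\<lambda>n. act n p) ` N"
      using m n p by (auto intro!: image_eqI[of _ _ "n \<otimes> m"] simp: act_mult N_carrier N_mult)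
    show "act n p \<in> (\<lambda>n. act n q) ` N"
    proof (rule image_eqI[of _ _ "n \<otimes> inv m"])
      show "n \<otimes> inv m \<in> N" using m n by (simp add: N_mult N_inv)
      have "act (n \<otimes> inv m) q = act ((n \<otimes> inv m) \<otimes> m) p"
        using m n p by (simp add: act_mult N_carrier)
      also have "(n \<otimes> inv m) \<otimes> m = n"
        using m n N_carrier by (simp add: m_assoc)
      finally show "act n p = act (n \<otimes> inv m) q" by simp
    qed
  qed
qed

text \<open>Since \<open>card U + 3 \<le> k\<close>, the orbit has a spare point \<open>r\<close>
  outside \<open>U\<close>, \<open>p\<close> and \<open>q\<close>; the element that
  \<open>three_cycle\<close> gives for \<open>p\<close>, \<open>q\<close>, \<open>r\<close> moves
  \<open>p\<close> to \<open>q\<close> and fixes \<open>U\<close>.\<close>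

lemma orb_large:
  assumes p0: "p0 \<in> \<Omega>" and O: "O' = (\<lambda>n. act n p0) ` N"
    and U: "U \<subseteq> O'" and p: "p \<in> O'" "p \<notin> U" and k: "card U + 3 \<le> k"
  shows "O' - U \<subseteq> orb U p"
proof
  fix q assume q: "q \<in> O' - U"
  have pO: "p \<in> \<Omega>" using p O orbit_closed[OF p0] by blast
  have Oeq: "O' = (\<lambda>n. act n p) ` N" using orbit_eq[OF p0] p O by blast
  have finO: "finite O'" using O finite_N by simp
  have XO: "U \<subseteq> \<Omega>" using U O orbit_closed[OF p0] by blast
  show "q \<in> orb U p"
  proof (cases "q = p")
    case True
    have "\<one> \<in> pstab U" using one_pstab[OF XO] .
    then show ?thesis unfolding orb_def using True act_one[OF pO] by force
  next
    case False
    have "card (U \<union> {p, q}) < card O'"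
    proof -
      have "card (U \<union> {p, q}) \<le> card U + 2"
        by (metis False card_2_iff card_Un_le)
      moreover have "card O' = k" using card_orbit[OF p0] O by simp
      ultimately show ?thesis using k by simp
    qed
    then have "\<not> O' \<subseteq> U \<union> {p, q}"
      using card_mono[of "U \<union> {p, q}" O'] finite_subset[OF U finO] by fastforce
    then obtain r where r: "r \<in> O'" "r \<notin> U" "r \<noteq> p" "r \<noteq> q"
      by blast
    obtain d where d: "d \<in> N" "act d p = q" "\<forall>z\<in>O'. z \<notin> {p, q, r} \<longrightarrow> act d z = z"
      using three_cycle[OF pO, folded Oeq, of q r] q r False by (metis DiffD1)
    have "act d z = z" if "z \<in> U" for z
      using d(3) that U p(2) q r(2) by (metis DiffD2 empty_iff insertE subsetD)
    then have "d \<in> pstab U" unfolding pstab_def using d(1) by simp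
    then show ?thesis unfolding orb_def using d by blast
  qed
qed

text \<open>The points of \<open>Y\<close> are fixed one at a time, and by \<open>orb_large\<close>
  the next one still has at least \<open>k - b\<close> images. The bound \<open>b\<close> on the
  final size stays constant in the induction, so a power replaces the falling factorial.\<close>

lemma card_N_ge:
  assumes p0: "p0 \<in> \<Omega>" and O: "O' = (\<lambda>n. act n p0) ` N"
    and Y: "Y \<subseteq> O'" and k: "b + 2 \<le> k" "card Y \<le> b"
  shows "(k - b) ^ card Y * card (pstab Y) \<le> card N"
proof -
  have finO: "finite O'" using O finite_N by simp
  have OO: "O' \<subseteq> \<Omega>" using O orbit_closed[OF p0] by blast
  have "finite Y" using finO Y finite_subset by blast
  then show ?thesis using Y k(2)
  proof (induction Y rule: finite_induct)
    case empty
    then show ?case by (simp add: pstab_empty)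
  next
    case (insert p U)
    then have U: "U \<subseteq> O'" and p: "p \<in> O'" and cX: "card U + 1 \<le> b" by auto
    have "O' - U \<subseteq> orb U p"
      using orb_large[OF p0 O U p insert.hyps(2)] cX k by simp
    then have "card (O' - U) \<le> card (orb U p)"
      using card_mono finite_orb by blast
    moreover have "card (O' - U) = k - card U"
      using card_Diff_subset[OF insert.hyps(1) U] card_orbit[OF p0] O by simp
    ultimately have *: "k - b \<le> card (orb U p)" using cX by simp
    have "(k - b) ^ card U * ((k - b) * card (pstab (insert p U)))
        \<le> (k - b) ^ card U * (card (orb U p) * card (pstab (insert p U)))"
      using * by simp
    also have "\<dots> = (k - b) ^ card U * card (pstab U)"
      using card_pstab_orb[OF subset_trans[OF U OO] subsetD[OF OO p]] by simp
    also have "\<dots> \<le> card N" using insert.IH U cX by simp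
    finally show ?case using insert.hyps by (simp add: ac_simps)
  qed
qed

section \<open>Points with a small orbit under a stabilizer\<close>

definition small_points :: "nat \<Rightarrow> 'p set \<Rightarrow> 'p set" where
  "small_points s F = {p \<in> \<Omega>. card (orb F p) < s}"

text \<open>Orbits can only shrink when more points are fixed, so a point that is small for
  \<open>F\<close> stays small for \<open>F \<union> Y\<close>, and each new point costs a factor of
  at most \<open>s\<close>.\<close>

lemma card_pstab_small_points:
  assumes F: "F \<subseteq> \<Omega>" and Y: "finite Y" "Y \<subseteq> small_points s F"
  shows "card (pstab F) \<le> s ^ card Y * card (pstab (F \<union> Y))"
  using Y
proof (induction Y rule: finite_induct)
  case empty
  then show ?case by simp
next
  case (insert p Y)
  have p: "p \<in> \<Omega>" "card (orb F p) < s" and YO: "Y \<subseteq> \<Omega>"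
    using insert.prems by (auto simp: small_points_def)
  have "orb (F \<union> Y) p \<subseteq> orb F p"
    unfolding orb_def using pstab_antimono[of F "F \<union> Y"] by blast
  then have *: "card (orb (F \<union> Y) p) \<le> s"
    using p card_mono[OF finite_orb] by (meson less_imp_le_nat order_trans)
  have "card (pstab F) \<le> s ^ card Y * card (pstab (F \<union> Y))"
    using insert by simp
  also have "\<dots> = s ^ card Y * (card (orb (F \<union> Y) p) * card (pstab (insert p (F \<union> Y))))"
    using card_pstab_orb[of "F \<union> Y" p] F YO p by simp
  also have "\<dots> \<le> s ^ card Y * (s * card (pstab (insert p (F \<union> Y))))"
    using * by simp
  finally show ?case using insert.hyps by (simp add: ac_simps)
qed

text \<open>If \<open>Suc r\<close> points \<open>Y\<close> of an orbit were small, fixing \<open>Y\<close> on top of \<open>F\<close> would cost an index of at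
  most \<open>s ^ Suc r\<close>, so the stabilizer of \<open>Y\<close> would have index at most \<open>k ^ r * s ^ Suc r\<close> in \<open>N\<close>, less
  than the index \<open>k (k - 1) \<dots> (k - r)\<close> it has in an alternating action.\<close>

lemma card_small_points_orbit:
  assumes F: "finite F" "F \<subseteq> \<Omega>" "card F = r" and p0: "p0 \<in> \<Omega>"
    and k: "r + 3 \<le> k" "k ^ r * s ^ Suc r < (k - Suc r) ^ Suc r"
  shows "card ((\<lambda>n. act n p0) ` N \<inter> small_points s F) \<le> r"
proof (rule ccontr)
  assume "\<not> ?thesis"
  then obtain Y where Y: "Y \<subseteq> (\<lambda>n. act n p0) ` N \<inter> small_points s F" "card Y = Suc r" "finite Y"
    by (metis not_less_eq_eq obtain_subset_with_card_n)
  then have YO: "Y \<subseteq> \<Omega>" by (auto simp: small_points_def)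
  have kr: "Suc r + 2 \<le> k" using k by simp
  have "(k - Suc r) ^ Suc r * card (pstab Y) \<le> card N"
    using card_N_ge[OF p0 refl _ kr, of Y] Y by (metis le_inf_iff order_refl)
  also have "\<dots> \<le> k ^ r * card (pstab F)"
    using card_N_le[of F] F by simp
  also have "\<dots> \<le> k ^ r * (s ^ Suc r * card (pstab (F \<union> Y)))"
    using card_pstab_small_points[of F Y s] F Y by (metis le_inf_iff mult_le_mono2)
  also have "\<dots> \<le> k ^ r * (s ^ Suc r * card (pstab Y))"
    using card_mono[OF finite_pstab pstab_antimono[of Y "F \<union> Y"]] by (intro mult_le_mono) auto
  finally have "(k - Suc r) ^ Suc r * card (pstab Y) \<le> (k ^ r * s ^ Suc r) * card (pstab Y)"
    by (simp only: mult.assoc)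
  then show False using mult_less_mono1[OF k(2) card_pstab_pos[OF YO]] by (rule leD[THEN notE])
qed

end

section \<open>Random walks along reduced words\<close>

text \<open>The law of total probability, cleared of denominators: \<open>m / s\<close> bounds the
  proportion of \<open>Q\<close> on each fiber of \<open>f\<close> and hence overall.\<close>

lemma card_fibers_le:
  fixes s m :: nat
  assumes "finite E"
    and "\<And>x. x \<in> E \<Longrightarrow>
      card {y \<in> E. f y = f x \<and> Q y} * s \<le> m * card {y \<in> E. f y = f x}"
  shows "card {x \<in> E. Q x} * s \<le> m * card E"
proof -
  have "card {x \<in> E. Q x} = (\<Sum>c\<in>f ` {x \<in> E. Q x}. card {y \<in> {x \<in> E. Q x}. f y = c})"
    using sum.image_gen[of "{x \<in> E. Q x}" "\<lambda>_. 1::nat" f] assms(1) by simp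
  also have "\<dots> = (\<Sum>c\<in>f ` {x \<in> E. Q x}. card {y \<in> E. f y = c \<and> Q y})"
    by (intro sum.cong arg_cong[of _ _ card]) auto
  also have "\<dots> \<le> (\<Sum>c\<in>f ` E. card {y \<in> E. f y = c \<and> Q y})"
    using assms(1) by (intro sum_mono2) auto
  finally have "card {x \<in> E. Q x} * s \<le> (\<Sum>c\<in>f ` E. card {y \<in> E. f y = c \<and> Q y}) * s"
    by simp
  also have "\<dots> = (\<Sum>c\<in>f ` E. card {y \<in> E. f y = c \<and> Q y} * s)"
    by (rule sum_distrib_right)
  also have "\<dots> \<le> (\<Sum>c\<in>f ` E. m * card {y \<in> E. f y = c})"
    using assms(2) by (intro sum_mono) auto
  also have "\<dots> = m * (\<Sum>c\<in>f ` E. card {y \<in> E. f y = c})"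
    by (rule sum_distrib_left[symmetric])
  also have "(\<Sum>c\<in>f ` E. card {y \<in> E. f y = c}) = card E"
    using sum.image_gen[of E "\<lambda>_. 1::nat" f] assms(1) by simp
  finally show ?thesis .
qed

lemma (in group) eval_word_closed:
  "\<forall>(i, b)\<in>set w. x i \<in> carrier G \<Longrightarrow> eval_word G x w \<in> carrier G"
  by (induction w) (auto split: if_splits)

lemma reduced_word_ConsD:
  assumes "reduced_word ((v, b) # w)"
  shows "reduced_word w" "w = [] \<or> hd w \<noteq> (v, \<not> b)"
  using assms by (cases w; force)+

context alternating_action
begin

text \<open>\<open>eval_word\<close> multiplies from the left, so the walk reads the word from its
  last letter to its first, and the suffixes of the word are its times.\<close>

definition point :: "'p \<Rightarrow> (nat \<Rightarrow> 'a) \<Rightarrow> (nat \<times> bool) list \<Rightarrow> 'p" where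
  "point p0 x w = act (eval_word H x w) p0"

text \<open>The current point is left out on purpose: the next step is resampled by elements that
  fix the earlier points and may move the current one.\<close>

primrec visited :: "'p \<Rightarrow> (nat \<Rightarrow> 'a) \<Rightarrow> (nat \<times> bool) list \<Rightarrow> 'p set" where
  "visited p0 x [] = {}"
| "visited p0 x (a # w) = insert (point p0 x w) (visited p0 x w)"

text \<open>A point of \<open>\<Omega>\<close> outside \<open>small_points\<close> has at least
  \<open>s\<close> images under the stabilizer of the past, which spreads out the next step; if
  \<open>2 \<le> s\<close>, it also differs from all earlier points.\<close>

primrec good :: "nat \<Rightarrow> 'p \<Rightarrow> (nat \<Rightarrow> 'a) \<Rightarrow> (nat \<times> bool) list \<Rightarrow> bool" where
  "good s p0 x [] \<longleftrightarrow> p0 \<notin> small_points s {}"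
| "good s p0 x (a # w) \<longleftrightarrow>
     good s p0 x w \<and> point p0 x (a # w) \<notin> small_points s (visited p0 x (a # w))"

text \<open>Multiplies the value of the letter \<open>(v, b)\<close> by \<open>d\<close> on the right. For \<open>d\<close> fixing the visited points
  this resamples the next step of the walk without changing its past.\<close>

definition twist :: "nat \<Rightarrow> bool \<Rightarrow> 'a \<Rightarrow> (nat \<Rightarrow> 'a) \<Rightarrow> nat \<Rightarrow> 'a" where
  "twist v b d x = x(v := if b then x v \<otimes> d else inv d \<otimes> x v)"

definition letter :: "(nat \<Rightarrow> 'a) \<Rightarrow> nat \<Rightarrow> bool \<Rightarrow> 'a" where
  "letter x i c = (if c then x i else inv (x i))"

lemma letter_closed: "x i \<in> carrier H \<Longrightarrow> letter x i c \<in> carrier H"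
  by (simp add: letter_def)

lemma letter_twist:
  assumes "x v \<in> carrier H" "d \<in> carrier H"
  shows "letter (twist v b d x) v c = (if c = b then letter x v c \<otimes> d else inv d \<otimes> letter x v c)"
  using assms by (auto simp: letter_def twist_def inv_mult_group)

lemma letter_twist_other: "i \<noteq> v \<Longrightarrow> letter (twist v b d x) i c = letter x i c"
  by (simp add: letter_def twist_def)

lemma point_closed:
  "p0 \<in> \<Omega> \<Longrightarrow> \<forall>(i, b)\<in>set w. x i \<in> carrier H \<Longrightarrow> point p0 x w \<in> \<Omega>"
  by (simp add: point_def act_closed eval_word_closed)

lemma point_Nil: "p0 \<in> \<Omega> \<Longrightarrow> point p0 x [] = p0"
  by (simp add: point_def act_one)

lemma point_Cons:
  assumes "p0 \<in> \<Omega>" "\<forall>(i, b)\<in>set ((i, c) # w). x i \<in> carrier H"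
  shows "point p0 x ((i, c) # w) = act (letter x i c) (point p0 x w)"
proof -
  have "eval_word H x w \<in> carrier H" using assms(2) by (intro eval_word_closed) auto
  moreover have "letter x i c \<in> carrier H" using assms(2) by (auto simp: letter_def)
  ultimately have "act (letter x i c \<otimes> eval_word H x w) p0 = act (letter x i c) (point p0 x w)"
    unfolding point_def using act_mult assms(1) by blast
  then show ?thesis by (simp add: point_def letter_def)
qed

lemma visited_subset:
  "p0 \<in> \<Omega> \<Longrightarrow> \<forall>(i, b)\<in>set w. x i \<in> carrier H \<Longrightarrow> visited p0 x w \<subseteq> \<Omega>"
  by (induction w) (auto simp: point_closed)

lemma finite_visited: "finite (visited p0 x w)"
  by (induction w) auto

lemma card_visited: "card (visited p0 x w) \<le> length w"
  by (induction w) (auto simp: finite_visited card_insert_if)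

lemma base_visited: "p0 \<in> \<Omega> \<Longrightarrow> w \<noteq> [] \<Longrightarrow> p0 \<in> visited p0 x w"
proof (induction w)
  case (Cons a w)
  then show ?case by (cases "w = []") (auto simp: point_Nil)
qed simp

lemma good_point: "p0 \<in> \<Omega> \<Longrightarrow> good s p0 x w \<Longrightarrow> point p0 x w \<notin> small_points s (visited p0 x w)"
  by (cases w) (auto simp: point_Nil)

lemma subset_small_points:
  assumes "F \<subseteq> \<Omega>" "2 \<le> s"
  shows "F \<subseteq> small_points s F"
proof
  fix p assume p: "p \<in> F"
  have "orb F p \<subseteq> {p}" using p by (auto simp: orb_def pstab_def)
  then have "card (orb F p) \<le> 1"
    using card_mono[of "{p}" "orb F p"] by simp
  then show "p \<in> small_points s F" using assms p by (auto simp: small_points_def)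
qed

text \<open>A trivial word would bring the walk back to \<open>p0\<close>, which a nonempty word has
  visited; but the stabilizer of the visited points gives each of them an orbit of size 1, below
  \<open>s\<close>.\<close>

lemma good_eval_word_neq_one:
  assumes "p0 \<in> \<Omega>" "\<forall>(i, b)\<in>set w. x i \<in> carrier H" "2 \<le> s" "w \<noteq> []" "good s p0 x w"
  shows "eval_word H x w \<noteq> \<one>"
proof
  assume "eval_word H x w = \<one>"
  then have "point p0 x w = p0" by (simp add: point_def act_one assms)
  then have "p0 \<notin> small_points s (visited p0 x w)" using good_point assms by metis
  then show False
    using base_visited[OF assms(1,4)] subset_small_points[OF visited_subset[OF assms(1,2)] assms(3)] by blast
qed

text \<open>Where the walk uses \<open>(v, b)\<close>, the factor \<open>d\<close> acts on the point
  before the step; where it uses \<open>(v, \<not> b)\<close>, \<open>inv d\<close> acts on the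
  point after it. All these points are visited ones, fixed by \<open>d\<close>, except the current
  point, reached by the front letter. Reducedness excludes \<open>(v, \<not> b)\<close> there; the
  third alternative of \<open>h\<close> is what the induction supplies for proper suffixes, whose
  current point is visited by the longer word.\<close>

lemma twist_walk:
  assumes p0: "p0 \<in> \<Omega>" and x: "\<forall>(i, c)\<in>set w. x i \<in> carrier H" and xv: "x v \<in> carrier H"
    and d: "d \<in> pstab (visited p0 x w)"
    and h: "w = [] \<or> hd w \<noteq> (v, \<not> b) \<or> act d (point p0 x w) = point p0 x w"
  shows "point p0 (twist v b d x) w = point p0 x w"
    and "visited p0 (twist v b d x) w = visited p0 x w"
    and "good s p0 (twist v b d x) w \<longleftrightarrow> good s p0 x w"
  using x d h
proof (induction w)
  case Nil
  { case 1 show ?case using p0 by (simp add: point_Nil) }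
  { case 2 show ?case by simp }
  { case 3 show ?case by simp }
next
  case (Cons a u)
  obtain i c where a: "a = (i, c)" by (cases a)
  { assume x: "\<forall>(i, c)\<in>set (a # u). x i \<in> carrier H"
      and d: "d \<in> pstab (visited p0 x (a # u))"
      and h: "a # u = [] \<or> hd (a # u) \<noteq> (v, \<not> b) \<or>
        act d (point p0 x (a # u)) = point p0 x (a # u)"
    have xu: "\<forall>(i, c)\<in>set u. x i \<in> carrier H" and xi: "x i \<in> carrier H"
      using x a by auto
    have dc: "d \<in> carrier H" using d pstab_carrier by blast
    have du: "d \<in> pstab (visited p0 x u)" and dp: "act d (point p0 x u) = point p0 x u"
      using d by (auto simp: pstab_def)
    have hu: "u = [] \<or> hd u \<noteq> (v, \<not> b) \<or> act d (point p0 x u) = point p0 x u"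
      using dp by blast
    note IH = Cons.IH(1)[OF xu du hu] Cons.IH(2)[OF xu du hu] Cons.IH(3)[OF xu du hu]
    let ?y = "twist v b d x"
    have tc: "?y j \<in> carrier H" if "x j \<in> carrier H" for j
      using that xv dc by (simp add: twist_def)
    have yc: "\<forall>(i, c)\<in>set (a # u). ?y i \<in> carrier H"
      using x tc by auto
    have pu: "point p0 x u \<in> \<Omega>" using point_closed[OF p0 xu] .
    have e1: "point p0 ?y (a # u) = act (letter ?y i c) (point p0 x u)"
      using point_Cons[OF p0 yc[unfolded a]] IH(1) a by simp
    have e2: "point p0 x (a # u) = act (letter x i c) (point p0 x u)"
      using point_Cons[OF p0 x[unfolded a]] a by simp
    have lc: "letter x i c \<in> carrier H" using xi by (rule letter_closed)
    have pt: "point p0 ?y (a # u) = point p0 x (a # u)"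
    proof (cases "i = v")
      case False
      then show ?thesis using e1 e2 letter_twist_other by simp
    next
      case iv: True
      show ?thesis
      proof (cases "c = b")
        case True
        then have "point p0 ?y (a # u) = act (letter x i c \<otimes> d) (point p0 x u)"
          using e1 letter_twist[of x v d b c, OF xv dc] iv by simp
        also have "\<dots> = act (letter x i c) (act d (point p0 x u))"
          by (rule act_mult[OF lc dc pu])
        finally show ?thesis using e2 dp by simp
      next
        case False
        then have "hd (a # u) = (v, \<not> b)" using a iv by auto
        then have fx: "act d (point p0 x (a # u)) = point p0 x (a # u)" using h by auto
        have "point p0 ?y (a # u) = act (inv d \<otimes> letter x i c) (point p0 x u)"
          using False e1 letter_twist[of x v d b c, OF xv dc] iv by simp
        also have "\<dots> = act (inv d) (point p0 x (a # u))"
          using act_mult[OF inv_closed[OF dc] lc pu] e2 by simp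
        also have "\<dots> = act (inv d) (act d (point p0 x (a # u)))"
          using fx by simp
        also have "\<dots> = point p0 x (a # u)"
          by (rule act_inv_act[OF dc point_closed[OF p0 x]])
        finally show ?thesis .
      qed
    qed
    have vs: "visited p0 ?y (a # u) = visited p0 x (a # u)"
      using IH by simp
    have "good s p0 ?y (a # u) = good s p0 x (a # u)"
      using IH pt vs by simp
    note pt vs this
  } note * = this
  { case 1 then show ?case by (rule *(1)) }
  { case 2 then show ?case by (rule *(2)) }
  { case 3 then show ?case by (rule *(3)) }
qed

section \<open>Classes of tuples under the free right action by twisting\<close>

lemma twist_twist:
  assumes "x v \<in> carrier H" "d \<in> carrier H" "e \<in> carrier H"
  shows "twist v b e (twist v b d x) = twist v b (d \<otimes> e) x"
  using assms by (auto simp: twist_def m_assoc inv_mult_group)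

lemma twist_one: "x v \<in> carrier H \<Longrightarrow> twist v b \<one> x = x"
  by (auto simp: twist_def)

lemma inj_twist:
  assumes "x v \<in> carrier H"
  shows "inj_on (\<lambda>d. twist v b d x) (carrier H)"
proof (rule inj_onI)
  fix d e assume de: "d \<in> carrier H" "e \<in> carrier H" "twist v b d x = twist v b e x"
  from fun_cong[OF de(3), of v] show "d = e"
    using de(1,2) assms by (cases b) (auto simp: twist_def)
qed

lemma pstab_left_mult:
  assumes "U \<subseteq> \<Omega>" "d \<in> pstab U"
  shows "(\<lambda>e. d \<otimes> e) ` pstab U = pstab U"
proof (intro equalityI subsetI)
  fix y assume "y \<in> (\<lambda>e. d \<otimes> e) ` pstab U"
  then show "y \<in> pstab U" using pstab_mult assms by blast
next
  fix y assume y: "y \<in> pstab U"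
  have "y = d \<otimes> (inv d \<otimes> y)"
    using pstab_carrier[OF y] pstab_carrier[OF assms(2)] by (simp add: m_assoc[symmetric])
  moreover have "inv d \<otimes> y \<in> pstab U"
    using pstab_mult pstab_inv assms y by blast
  ultimately show "y \<in> (\<lambda>e. d \<otimes> e) ` pstab U" by blast
qed

text \<open>Normality of \<open>N\<close> puts all candidates for the next point into one
  \<open>N\<close>-orbit, so the count of small points per orbit applies to them.\<close>

lemma conj_orbit:
  assumes y: "y \<in> carrier H" and d: "d \<in> N" and p: "p \<in> \<Omega>"
  shows "act y (act d p) \<in> (\<lambda>n. act n (act y p)) ` N"
proof (rule image_eqI)
  show "y \<otimes> d \<otimes> inv y \<in> N"
    using normal.inv_op_closed2[OF normal_N y d] .
  have "act (y \<otimes> d \<otimes> inv y) (act y p) = act (y \<otimes> d) (act (inv y) (act y p))"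
    using y d p by (simp add: act_mult act_closed N_carrier)
  also have "\<dots> = act (y \<otimes> d) p" using act_inv_act[OF y p] by simp
  also have "\<dots> = act y (act d p)" using y N_carrier[OF d] p by (rule act_mult)
  finally show "act y (act d p) = act (y \<otimes> d \<otimes> inv y) (act y p)" ..
qed

definition tuples :: "nat \<Rightarrow> (nat \<Rightarrow> 'a) set" where
  "tuples n = ({..<n} \<rightarrow>\<^sub>E carrier H)"

lemma finite_tuples: "finite (tuples n)"
  by (simp add: tuples_def finite_PiE finite_carrier)

lemma tuples_carrier: "x \<in> tuples n \<Longrightarrow> i < n \<Longrightarrow> x i \<in> carrier H"
  by (auto simp: tuples_def)

lemma twist_tuples: "x \<in> tuples n \<Longrightarrow> v < n \<Longrightarrow> d \<in> carrier H \<Longrightarrow> twist v b d x \<in> tuples n"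
  by (auto simp: tuples_def twist_def PiE_iff extensional_def)

text \<open>The tuples are grouped into classes under \<open>twist\<close>; on each class the next point of the walk is
  uniformly distributed on a translate of a large orbit.\<close>

lemma card_bad_step:
  assumes p0: "p0 \<in> \<Omega>" and v: "v < n" and w: "\<forall>(i, c)\<in>set w. i < n"
    and red: "w = [] \<or> hd w \<noteq> (v, \<not> b)"
    and k: "\<And>r. r \<le> Suc (length w) \<Longrightarrow> r + 3 \<le> k \<and> k ^ r * s ^ Suc r < (k - Suc r) ^ Suc r"
  shows "card {x \<in> tuples n. good s p0 x w \<and> \<not> good s p0 x ((v, b) # w)} * s
      \<le> Suc (length w) * card (tuples n)"
proof -
  define E where "E = {x \<in> tuples n. good s p0 x w}"
  \<comment> \<open>The class of \<open>x\<close>, taken as a value so that the classes become the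
    fibers of a function.\<close>
  define \<kappa> where "\<kappa> x = (\<lambda>d. twist v b d x) ` pstab (visited p0 x w)" for x
  have finE: "finite E" by (simp add: E_def finite_tuples)
  have "card {x \<in> E. \<not> good s p0 x ((v, b) # w)} * s \<le> Suc (length w) * card E"
  proof (rule card_fibers_le[where f = \<kappa>, OF finE])
    fix x assume x: "x \<in> E"
    then have xT: "x \<in> tuples n" and gx: "good s p0 x w" by (auto simp: E_def)
    have xv: "x v \<in> carrier H" using tuples_carrier[OF xT v] .
    have xw: "\<forall>(i, c)\<in>set w. x i \<in> carrier H" using w tuples_carrier[OF xT] by auto
    have xvw: "\<forall>(i, c)\<in>set ((v, b) # w). x i \<in> carrier H" using xw xv by auto
    let ?F = "visited p0 x w"
    let ?D = "pstab ?F"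
    let ?p = "point p0 x w"
    let ?y = "letter x v b"
    let ?G = "visited p0 x ((v, b) # w)"
    have F: "?F \<subseteq> \<Omega>" using visited_subset[OF p0 xw] .
    have p: "?p \<in> \<Omega>" using point_closed[OF p0 xw] .
    have y: "?y \<in> carrier H" using xv by (rule letter_closed)
    have D_car: "?D \<subseteq> carrier H" using pstab_carrier by blast
    have walk: "point p0 (twist v b d x) w = ?p" "visited p0 (twist v b d x) w = ?F"
      "good s p0 (twist v b d x) w" if "d \<in> ?D" for d
      using twist_walk[OF p0 xw xv that] red gx by blast+
    have mem: "twist v b d x \<in> E" if "d \<in> ?D" for d
      using walk(3)[OF that] twist_tuples[OF xT v] D_car that by (auto simp: E_def)
    \<comment> \<open>The stabilizer that defines the class depends only on the past, which twisting
      by \<open>d\<close> preserves; left multiplication by \<open>d\<close> merely permutes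
      it.\<close>
    have kap: "\<kappa> (twist v b d x) = \<kappa> x" if d: "d \<in> ?D" for d
    proof -
      have "\<kappa> (twist v b d x) = (\<lambda>e. twist v b e (twist v b d x)) ` ?D"
        using walk(2)[OF d] by (simp add: \<kappa>_def)
      also have "\<dots> = (\<lambda>e. twist v b (d \<otimes> e) x) ` ?D"
        using twist_twist[of x v, OF xv] D_car d by (intro image_cong) auto
      also have "\<dots> = (\<lambda>e. twist v b e x) ` ((\<lambda>e. d \<otimes> e) ` ?D)"
        by (simp add: image_image)
      finally show ?thesis using pstab_left_mult[OF F d] by (simp add: \<kappa>_def)
    qed
    have self: "x' \<in> \<kappa> x'" if "x' \<in> E" for x'
    proof -
      have x': "x' \<in> tuples n" using that by (simp add: E_def)
      have "\<forall>(i, c)\<in>set w. x' i \<in> carrier H" using w tuples_carrier[OF x'] by auto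
      then have "\<one> \<in> pstab (visited p0 x' w)" using one_pstab visited_subset[OF p0] by blast
      then show ?thesis unfolding \<kappa>_def using twist_one[of x' v, OF tuples_carrier[OF x' v]]
        by (metis imageI)
    qed
    have fib: "{x' \<in> E. \<kappa> x' = \<kappa> x} = (\<lambda>d. twist v b d x) ` ?D"
    proof (intro equalityI subsetI)
      fix x' assume "x' \<in> {x' \<in> E. \<kappa> x' = \<kappa> x}"
      then show "x' \<in> (\<lambda>d. twist v b d x) ` ?D" using self \<kappa>_def by auto
    next
      fix x' assume "x' \<in> (\<lambda>d. twist v b d x) ` ?D"
      then show "x' \<in> {x' \<in> E. \<kappa> x' = \<kappa> x}" using mem kap by blast
    qed
    have inj: "inj_on (\<lambda>d. twist v b d x) ?D"
      using inj_twist[of x v, OF xv] D_car inj_on_subset by blast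
    have c1: "card {x' \<in> E. \<kappa> x' = \<kappa> x} = card ?D"
      using fib card_image[OF inj] by simp
    have bad: "good s p0 (twist v b d x) ((v, b) # w) \<longleftrightarrow> act ?y (act d ?p) \<notin> small_points s ?G"
      if d: "d \<in> ?D" for d
    proof -
      have dc: "d \<in> carrier H" using d D_car by blast
      have tw: "\<forall>(i, c)\<in>set ((v, b) # w). twist v b d x i \<in> carrier H"
        using xvw xv dc by (auto simp: twist_def)
      have "point p0 (twist v b d x) ((v, b) # w) = act (?y \<otimes> d) ?p"
        using point_Cons[OF p0 tw] letter_twist[of x v d b b, OF xv dc] walk(1)[OF d] by simp
      also have "\<dots> = act ?y (act d ?p)" by (rule act_mult[OF y dc p])
      finally show ?thesis using walk[OF d] by simp
    qed
    \<comment> \<open>The candidates for the next point are the translates \<open>act ?y q\<close>;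
      \<open>Q\<close> collects the \<open>q\<close> with an exceptional translate, and each of them
      is reached by equally many \<open>d\<close>.\<close>
    define Q where "Q = {q \<in> orb ?F ?p. act ?y q \<in> small_points s ?G}"
    have finQ: "finite Q" by (simp add: Q_def finite_orb)
    have "{x' \<in> E. \<kappa> x' = \<kappa> x \<and> \<not> good s p0 x' ((v, b) # w)}
        = {x' \<in> {x' \<in> E. \<kappa> x' = \<kappa> x}. \<not> good s p0 x' ((v, b) # w)}"
      by blast
    also have "\<dots> = {x' \<in> (\<lambda>d. twist v b d x) ` ?D. \<not> good s p0 x' ((v, b) # w)}"
      unfolding fib ..
    also have "\<dots> = (\<lambda>d. twist v b d x) ` {d \<in> ?D. act ?y (act d ?p) \<in> small_points s ?G}"
      using bad by (auto simp del: good.simps visited.simps)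
    finally have "{x' \<in> E. \<kappa> x' = \<kappa> x \<and> \<not> good s p0 x' ((v, b) # w)}
        = (\<lambda>d. twist v b d x) ` {d \<in> ?D. act ?y (act d ?p) \<in> small_points s ?G}" .
    then have c2: "card {x' \<in> E. \<kappa> x' = \<kappa> x \<and> \<not> good s p0 x' ((v, b) # w)}
        = card {d \<in> ?D. act ?y (act d ?p) \<in> small_points s ?G}"
      using card_image[OF inj_on_subset[OF inj]] by (metis (no_types, lifting) mem_Collect_eq subsetI)
    also have "\<dots> = (\<Sum>q\<in>(\<lambda>d. act d ?p) ` {d \<in> ?D. act ?y (act d ?p) \<in> small_points s ?G}.
        card {d \<in> {d \<in> ?D. act ?y (act d ?p) \<in> small_points s ?G}. act d ?p = q})"
      using sum.image_gen[of "{d \<in> ?D. act ?y (act d ?p) \<in> small_points s ?G}" "\<lambda>_. 1::nat" "\<lambda>d. act d ?p"]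
        finite_pstab by simp
    also have "(\<lambda>d. act d ?p) ` {d \<in> ?D. act ?y (act d ?p) \<in> small_points s ?G} = Q"
      by (auto simp: Q_def orb_def)
    also have "(\<Sum>q\<in>Q. card {d \<in> {d \<in> ?D. act ?y (act d ?p) \<in> small_points s ?G}. act d ?p = q})
        = (\<Sum>q\<in>Q. card {d \<in> ?D. act d ?p = q})"
      by (intro sum.cong refl arg_cong[of _ _ card]) (auto simp: Q_def)
    also have "\<dots> = (\<Sum>q\<in>Q. card (pstab (insert ?p ?F)))"
      using card_pstab_fiber[OF F p] by (intro sum.cong refl) (auto simp: Q_def)
    finally have c3: "card {x' \<in> E. \<kappa> x' = \<kappa> x \<and> \<not> good s p0 x' ((v, b) # w)}
        = card Q * card (pstab (insert ?p ?F))" by simp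
    have cG: "card ?G \<le> Suc (length w)"
      using card_visited[of p0 x "(v, b) # w"] by simp
    have "inj_on (act ?y) Q"
    proof (rule inj_on_inverseI)
      fix q assume "q \<in> Q"
      then have "q \<in> \<Omega>" using D_car p by (auto simp: Q_def orb_def intro: act_closed)
      then show "act (inv ?y) (act ?y q) = q" by (rule act_inv_act[OF y])
    qed
    moreover have "act ?y ` Q \<subseteq> (\<lambda>n. act n (act ?y ?p)) ` N \<inter> small_points s ?G"
      using conj_orbit[OF y _ p] pstab_subset by (auto simp: Q_def orb_def)
    moreover have "finite ((\<lambda>n. act n (act ?y ?p)) ` N \<inter> small_points s ?G)"
      using finite_N by simp
    ultimately have "card Q \<le> card ((\<lambda>n. act n (act ?y ?p)) ` N \<inter> small_points s ?G)"
      using card_inj_on_le by blast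
    also have "\<dots> \<le> card ?G"
      using card_small_points_orbit[OF finite_visited visited_subset[OF p0 xvw] refl act_closed[OF y p]]
        k[OF cG] by blast
    finally have cQ: "card Q \<le> Suc (length w)" using cG by simp
    \<comment> \<open>Goodness up to now is what bounds the denominator
      \<open>card (orb ?F ?p)\<close> from below by \<open>s\<close>.\<close>
    have "?p \<notin> small_points s ?F" using good_point[OF p0 gx] .
    then have "s \<le> card (orb ?F ?p)" using p by (simp add: small_points_def)
    then have "card Q * s \<le> Suc (length w) * card (orb ?F ?p)"
      using cQ by (rule mult_le_mono[rotated])
    then have "card Q * s * card (pstab (insert ?p ?F)) \<le>
        Suc (length w) * card (orb ?F ?p) * card (pstab (insert ?p ?F))"
      by (rule mult_le_mono1)
    then show "card {x' \<in> E. \<kappa> x' = \<kappa> x \<and> \<not> good s p0 x' ((v, b) # w)} * s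
        \<le> Suc (length w) * card {x' \<in> E. \<kappa> x' = \<kappa> x}"
      unfolding c3 c1 card_pstab_orb[OF F p] by (simp only: ac_simps)
  qed
  moreover have "{x \<in> E. \<not> good s p0 x ((v, b) # w)}
      = {x \<in> tuples n. good s p0 x w \<and> \<not> good s p0 x ((v, b) # w)}"
    by (auto simp: E_def)
  moreover have "card E \<le> card (tuples n)"
    by (intro card_mono finite_tuples) (auto simp: E_def)
  then have "Suc (length w) * card E \<le> Suc (length w) * card (tuples n)" by (rule mult_le_mono2)
  ultimately show ?thesis by (metis (no_types, lifting) order_trans)
qed

text \<open>A union bound over the steps, whose numerators \<open>1, ..., length w\<close> add up to
  at most the square. The start is settled by \<open>s \<le> k\<close>: nothing is fixed yet, and
  the orbit of \<open>p0\<close> has \<open>k\<close> points.\<close>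

lemma card_not_good:
  assumes p0: "p0 \<in> \<Omega>" and w: "\<forall>(i, c)\<in>set w. i < n" and red: "reduced_word w"
    and k: "\<And>r. r \<le> length w \<Longrightarrow> r + 3 \<le> k \<and> k ^ r * s ^ Suc r < (k - Suc r) ^ Suc r"
    and sk: "s \<le> k"
  shows "card {x \<in> tuples n. \<not> good s p0 x w} * s \<le> (length w)\<^sup>2 * card (tuples n)"
  using w red k
proof (induction w)
  case Nil
  have "orb {} p0 = (\<lambda>n. act n p0) ` N" by (simp add: orb_def pstab_empty)
  then have "p0 \<notin> small_points s {}" using card_orbit[OF p0] sk by (simp add: small_points_def)
  then show ?case by simp
next
  case (Cons a w)
  obtain v b where a: "a = (v, b)" by (cases a)
  let ?A = "{x \<in> tuples n. \<not> good s p0 x w}"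
  let ?B = "{x \<in> tuples n. good s p0 x w \<and> \<not> good s p0 x (a # w)}"
  have "{x \<in> tuples n. \<not> good s p0 x (a # w)} = ?A \<union> ?B" by auto
  then have "card {x \<in> tuples n. \<not> good s p0 x (a # w)} \<le> card ?A + card ?B"
    by (simp only: card_Un_le)
  then have "card {x \<in> tuples n. \<not> good s p0 x (a # w)} * s \<le> card ?A * s + card ?B * s"
    unfolding add_mult_distrib[symmetric] by (rule mult_le_mono1)
  moreover have "card ?A * s \<le> (length w)\<^sup>2 * card (tuples n)"
    using Cons a reduced_word_ConsD(1) by simp
  moreover have "card ?B * s \<le> Suc (length w) * card (tuples n)"
    unfolding a using Cons.prems a reduced_word_ConsD(2)
    by (intro card_bad_step[OF p0]) auto
  ultimately have "card {x \<in> tuples n. \<not> good s p0 x (a # w)} * s \<le>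
      ((length w)\<^sup>2 + Suc (length w)) * card (tuples n)"
    by (simp add: add_mult_distrib)
  also have "\<dots> \<le> (length (a # w))\<^sup>2 * card (tuples n)"
    by (intro mult_le_mono1) (simp add: power2_eq_square)
  finally show ?case .
qed

lemma card_eval_word_one:
  assumes "\<Omega> \<noteq> {}" and w: "\<forall>(i, c)\<in>set w. i < n" "reduced_word w" "w \<noteq> []"
    and s: "2 \<le> s"
    and k: "2 * length w + 3 + s + (2 * s) ^ Suc (length w) \<le> k"
  shows "card {x \<in> tuples n. eval_word H x w = \<one>} * s \<le> (length w)\<^sup>2 * card (tuples n)"
proof -
  obtain p0 where p0: "p0 \<in> \<Omega>" using assms(1) by blast
  \<comment> \<open>In the lower bound for \<open>k\<close>, the power gives
    \<open>(2 * s) ^ Suc r < k\<close>, and \<open>2 * length w + 3\<close> gives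
    \<open>k \<le> 2 * (k - Suc r)\<close>. Replacing \<open>k\<close> by \<open>k - Suc r\<close>
    loses \<open>2 ^ Suc r\<close>, which is why the power has base \<open>2 * s\<close> instead of
    \<open>s\<close>.\<close>
  have kr: "r + 3 \<le> k \<and> k ^ r * s ^ Suc r < (k - Suc r) ^ Suc r" if r: "r \<le> length w" for r
  proof
    show "r + 3 \<le> k" using r k by linarith
    have "(2 * s) ^ Suc r \<le> (2 * s) ^ Suc (length w)"
      using r s by (intro power_increasing) auto
    then have "(2 * s) ^ Suc r < k" using k by linarith
    moreover have "0 < k" using k by linarith
    ultimately have "k ^ r * (2 * s) ^ Suc r < k ^ r * k" by (intro mult_strict_left_mono) auto
    also have "\<dots> = k ^ Suc r" by simp
    also have "\<dots> \<le> (2 * (k - Suc r)) ^ Suc r"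
      using r k by (intro power_mono) auto
    finally have "2 ^ Suc r * (k ^ r * s ^ Suc r) < 2 ^ Suc r * (k - Suc r) ^ Suc r"
      by (simp only: power_mult_distrib ac_simps)
    then show "k ^ r * s ^ Suc r < (k - Suc r) ^ Suc r" by (rule mult_less_cancel1[THEN iffD1, THEN conjunct2])
  qed
  have "{x \<in> tuples n. eval_word H x w = \<one>} \<subseteq> {x \<in> tuples n. \<not> good s p0 x w}"
  proof safe
    fix x assume x: "x \<in> tuples n" "eval_word H x w = \<one>" "good s p0 x w"
    have "\<forall>(i, b)\<in>set w. x i \<in> carrier H" using w(1) tuples_carrier[OF x(1)] by auto
    then show False using good_eval_word_neq_one[OF p0 _ s w(3) x(3)] x(2) by blast
  qed
  then have "card {x \<in> tuples n. eval_word H x w = \<one>} \<le> card {x \<in> tuples n. \<not> good s p0 x w}"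
    by (intro card_mono) (simp add: finite_tuples)
  then have "card {x \<in> tuples n. eval_word H x w = \<one>} * s \<le> card {x \<in> tuples n. \<not> good s p0 x w} * s"
    by (rule mult_le_mono1)
  also have "\<dots> \<le> (length w)\<^sup>2 * card (tuples n)"
    using card_not_good[OF p0 w(1,2) kr] k by linarith
  finally show ?thesis .
qed

end

section \<open>Normal subgroups mapping onto a composition factor\<close>

context group
begin

lemma inv_mult_cancel:
  "x \<in> carrier G \<Longrightarrow> y \<in> carrier G \<Longrightarrow> inv x \<otimes> (x \<otimes> y) = y"
  "x \<in> carrier G \<Longrightarrow> y \<in> carrier G \<Longrightarrow> x \<otimes> (inv x \<otimes> y) = y"
  by (simp_all add: m_assoc[symmetric])

text \<open>Relative normality in terms of the operations of \<open>G\<close> itself, so that chains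
  and intersections of subgroups stay in one structure.\<close>

definition normal_in :: "'a set \<Rightarrow> 'a set \<Rightarrow> bool" where
  "normal_in A B \<longleftrightarrow> subgroup A G \<and> subgroup B G \<and> A \<subseteq> B \<and>
     (\<forall>b\<in>B. \<forall>a\<in>A. b \<otimes> a \<otimes> inv b \<in> A)"

lemma normal_in_normal:
  assumes "normal_in A B"
  shows "A \<lhd> G\<lparr>carrier := B\<rparr>"
proof -
  have A: "subgroup A G" and B: "subgroup B G" and AB: "A \<subseteq> B"
    and c: "\<And>a b. b \<in> B \<Longrightarrow> a \<in> A \<Longrightarrow> b \<otimes> a \<otimes> inv b \<in> A"
    using assms by (auto simp: normal_in_def)
  interpret B: group "G\<lparr>carrier := B\<rparr>" using subgroup_imp_group[OF B] .
  show ?thesis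
    unfolding B.normal_inv_iff
    using subgroup_incl[OF A B AB] c m_inv_consistent[OF B] by auto
qed

lemma normal_normal_in:
  assumes B: "subgroup B G" and n: "A \<lhd> G\<lparr>carrier := B\<rparr>"
  shows "normal_in A B"
proof -
  interpret B: group "G\<lparr>carrier := B\<rparr>" using subgroup_imp_group[OF B] .
  have s: "subgroup A (G\<lparr>carrier := B\<rparr>)" and
    c: "\<And>a b. b \<in> B \<Longrightarrow> a \<in> A \<Longrightarrow> b \<otimes> a \<otimes> inv b \<in> A"
    using n m_inv_consistent[OF B] by (auto simp: B.normal_inv_iff)
  have "A \<subseteq> B" using subgroup.subset[OF s] by simp
  then show ?thesis using B c incl_subgroup[OF B s] by (simp add: normal_in_def)
qed

lemma normal_in_carrier: "normal_in A (carrier G) \<longleftrightarrow> A \<lhd> G"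
  by (auto simp: normal_in_def normal_inv_iff subgroup_self dest: subgroup.subset)

inductive subnormal :: "'a set \<Rightarrow> bool" where
  subnormal_carrier: "subnormal (carrier G)"
| subnormal_step: "subnormal B \<Longrightarrow> normal_in A B \<Longrightarrow> subnormal A"

lemma subnormal_imp_subgroup: "subnormal A \<Longrightarrow> subgroup A G"
  by (induction rule: subnormal.induct) (auto simp: subgroup_self normal_in_def)

lemma normal_in_Int:
  assumes "normal_in A S" "normal_in B N" "S \<subseteq> N"
  shows "normal_in (A \<inter> B) S"
  using assms subgroups_Inter_pair unfolding normal_in_def by (simp add: subset_iff)

text \<open>A surjective homomorphism on a subset stands in for a quotient group: it can be
  restricted to smaller subgroups while the target stays the same.\<close>

definition maps_onto :: "('c, 'd) monoid_scheme \<Rightarrow> 'a set \<Rightarrow> ('a \<Rightarrow> 'c) \<Rightarrow> bool" where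
  "maps_onto Q A f \<longleftrightarrow> (\<forall>x\<in>A. \<forall>y\<in>A. f (x \<otimes> y) = f x \<otimes>\<^bsub>Q\<^esub> f y) \<and> f ` A = carrier Q"

lemma maps_onto_group_hom:
  assumes "group Q" "subgroup A G" "maps_onto Q A f"
  shows "group_hom (G\<lparr>carrier := A\<rparr>) Q f"
  using assms subgroup_imp_group
  by (auto simp: group_hom_def group_hom_axioms_def maps_onto_def hom_def)

lemma maps_onto_normal_in:
  assumes Q: "simple_group Q" and S: "maps_onto Q S f" and A: "normal_in A S"
  shows "f ` A = carrier Q \<or> f ` A = {\<one>\<^bsub>Q\<^esub>}"
proof -
  have "group Q" using Q simple_group.axioms(1) by blast
  moreover have "subgroup S G" using A by (simp add: normal_in_def)
  ultimately have "group_hom (G\<lparr>carrier := S\<rparr>) Q f" using maps_onto_group_hom S by blast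
  moreover have "f ` carrier (G\<lparr>carrier := S\<rparr>) = carrier Q" using S by (simp add: maps_onto_def)
  ultimately have "f ` A \<lhd> Q"
    using normal.surj_hom_normal_subgroup[OF normal_in_normal[OF A]] by blast
  then show ?thesis using simple_group.no_real_normal_subgroup[OF Q] by blast
qed

lemma maps_onto_subset:
  "maps_onto Q S f \<Longrightarrow> A \<subseteq> S \<Longrightarrow> f ` A = carrier Q \<Longrightarrow> maps_onto Q A f"
  by (auto simp: maps_onto_def subset_iff)

text \<open>Induction down the subnormal chain. If \<open>N = (B \<inter> N) K\<close>, then
  \<open>(A \<inter> N) K\<close> is normalized by both \<open>B \<inter> N\<close> and
  \<open>K\<close>, hence normal in \<open>N\<close>, and maximality leaves only \<open>K\<close>
  and \<open>N\<close>.\<close>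

lemma subnormal_dichotomy:
  assumes W: "subnormal W" and N: "N \<lhd> G" and K: "normal_in K N"
    and max: "\<And>L. normal_in L N \<Longrightarrow> K \<subseteq> L \<Longrightarrow> L = K \<or> L = N"
  shows "W \<inter> N \<subseteq> K \<or> N \<subseteq> (\<Union>x\<in>W \<inter> N. \<Union>k\<in>K. {x \<otimes> k})"
  using W
proof (induction rule: subnormal.induct)
  case subnormal_carrier
  have Ns: "subgroup N G" "subgroup K G" using K by (auto simp: normal_in_def)
  have "n \<in> (\<Union>x\<in>carrier G \<inter> N. \<Union>k\<in>K. {x \<otimes> k})" if n: "n \<in> N" for n
  proof -
    have "n \<in> carrier G" using n Ns subgroup.mem_carrier by metis
    then have "n = n \<otimes> \<one>" "n \<in> carrier G" by auto
    then show ?thesis using n subgroup.one_closed[OF Ns(2)] by blast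
  qed
  then show ?case by blast
next
  case (subnormal_step B A)
  have A: "subgroup A G" and B: "subgroup B G" and AB: "A \<subseteq> B"
    and cA: "\<And>a b. b \<in> B \<Longrightarrow> a \<in> A \<Longrightarrow> b \<otimes> a \<otimes> inv b \<in> A"
    using subnormal_step.hyps(2) by (auto simp: normal_in_def)
  have Ns: "subgroup N G" and Ks: "subgroup K G" and KN: "K \<subseteq> N"
    and cK: "\<And>a b. b \<in> N \<Longrightarrow> a \<in> K \<Longrightarrow> b \<otimes> a \<otimes> inv b \<in> K"
    using K by (auto simp: normal_in_def)
  interpret A: subgroup A G by fact
  interpret B: subgroup B G by fact
  interpret N: subgroup N G by fact
  interpret K: subgroup K G by fact
  show ?case
  proof (cases "B \<inter> N \<subseteq> K")
    case True
    then show ?thesis using AB by blast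
  next
    case False
    then have NB: "\<And>n. n \<in> N \<Longrightarrow> \<exists>x\<in>B \<inter> N. \<exists>k\<in>K. n = x \<otimes> k"
      using subnormal_step.IH by blast
    define L where "L = (\<Union>x\<in>A \<inter> N. \<Union>k\<in>K. {x \<otimes> k})"
    have LI: "x \<otimes> k \<in> L" if "x \<in> A" "x \<in> N" "k \<in> K" for x k
      using that by (auto simp: L_def)
    have LE: "\<exists>x k. x \<in> A \<and> x \<in> N \<and> k \<in> K \<and> y = x \<otimes> k" if "y \<in> L" for y
      using that by (auto simp: L_def)
    have cK': "inv b \<otimes> a \<otimes> b \<in> K" if "b \<in> N" "a \<in> K" for a b
      using cK[of "inv b" a] that by simp
    have KL: "K \<subseteq> L"
    proof
      fix k assume "k \<in> K"
      then have "\<one> \<otimes> k \<in> L" "\<one> \<otimes> k = k" using LI[of \<one> k] by auto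
      then show "k \<in> L" by simp
    qed
    have LN: "L \<subseteq> N" using KN by (auto simp: L_def)
    have multL: "y \<otimes> z \<in> L" if yz: "y \<in> L" "z \<in> L" for y z
    proof -
      obtain x k where x: "x \<in> A" "x \<in> N" "k \<in> K" "y = x \<otimes> k" using LE yz by blast
      obtain x' k' where x': "x' \<in> A" "x' \<in> N" "k' \<in> K" "z = x' \<otimes> k'" using LE yz by blast
      have "y \<otimes> z = (x \<otimes> x') \<otimes> ((inv x' \<otimes> k \<otimes> x') \<otimes> k')"
        using x x' by (simp add: m_assoc inv_mult_cancel)
      then show ?thesis using x x' cK' LI by auto
    qed
    have conjL: "n \<otimes> y \<otimes> inv n \<in> L" if n: "n \<in> N" and y: "y \<in> L" for n y
    proof -
      obtain x k where x: "x \<in> A" "x \<in> N" "k \<in> K" "y = x \<otimes> k" using LE y by blast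
      obtain b l where b: "b \<in> B" "b \<in> N" "l \<in> K" "n = b \<otimes> l" using NB n by blast
      have carr: "x \<in> carrier G" "k \<in> carrier G" "b \<in> carrier G" "l \<in> carrier G" "n = b \<otimes> l" "y = x \<otimes> k"
        using x b by auto
      \<comment> \<open>Moving \<open>l\<close> past \<open>x\<close> conjugates it by
        \<open>x\<close>; normality of \<open>K\<close> in \<open>N\<close> keeps what remains in
        \<open>K\<close>.\<close>
      have k': "(inv x \<otimes> l \<otimes> x) \<otimes> (k \<otimes> inv l) \<in> K"
        using cK'[of x l] x b by auto
      have "n \<otimes> y \<otimes> inv n =
          (b \<otimes> x \<otimes> inv b) \<otimes> (b \<otimes> ((inv x \<otimes> l \<otimes> x) \<otimes> (k \<otimes> inv l)) \<otimes> inv b)"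
        using carr by (simp add: m_assoc inv_mult_cancel inv_mult_group)
      moreover have "b \<otimes> x \<otimes> inv b \<in> A" "b \<otimes> x \<otimes> inv b \<in> N"
        using cA b x by auto
      ultimately show ?thesis using cK[OF b(2) k'] LI by simp
    qed
    have invL: "inv y \<in> L" if y: "y \<in> L" for y
    proof -
      obtain x k where x: "x \<in> A" "x \<in> N" "k \<in> K" "y = x \<otimes> k" using LE y by blast
      have "inv y = inv x \<otimes> (x \<otimes> inv k \<otimes> inv x)"
        using x by (simp add: m_assoc inv_mult_cancel inv_mult_group)
      then show ?thesis using LI[of "inv x" "x \<otimes> inv k \<otimes> inv x"] x cK by auto
    qed
    have "subgroup L G"
    proof (rule subgroupI)
      show "L \<subseteq> carrier G" using LN N.subset by (rule subset_trans)
      show "L \<noteq> {}" using KL K.one_closed by blast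
    qed (rule invL multL; assumption)+
    then have "normal_in L N" using Ns LN conjL by (simp add: normal_in_def)
    then have "L = K \<or> L = N" using max KL by blast
    then show ?thesis
    proof
      assume LK: "L = K"
      have "A \<inter> N \<subseteq> L"
      proof
        fix x assume x: "x \<in> A \<inter> N"
        then have "x \<otimes> \<one> \<in> L" using LI[of x \<one>] K.one_closed by blast
        moreover have "x \<in> carrier G" using x by auto
        ultimately show "x \<in> L" by (simp only: r_one)
      qed
      then show ?thesis using LK by blast
    next
      assume "L = N"
      then show ?thesis by (auto simp: L_def)
    qed
  qed
qed

text \<open>The set is the conjugate of \<open>L\<close> by \<open>h\<close>, and conjugation by
  \<open>h\<close> is an automorphism of \<open>N\<close>.\<close>

lemma conj_normal_in:
  assumes N: "N \<lhd> G" and L: "normal_in L N" and h: "h \<in> carrier G"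
  shows "normal_in {x \<in> N. inv h \<otimes> x \<otimes> h \<in> L} N"
proof -
  have Ls: "subgroup L G" and Ns: "subgroup N G" and LN: "L \<subseteq> N"
    and c: "\<And>a b. b \<in> N \<Longrightarrow> a \<in> L \<Longrightarrow> b \<otimes> a \<otimes> inv b \<in> L"
    using L by (auto simp: normal_in_def)
  interpret L: subgroup L G by fact
  interpret N: normal N G by fact
  have e1: "inv h \<otimes> (x \<otimes> y) \<otimes> h = (inv h \<otimes> x \<otimes> h) \<otimes> (inv h \<otimes> y \<otimes> h)"
    if "x \<in> N" "y \<in> N" for x y
    using that h by (simp add: m_assoc inv_mult_cancel)
  have e2: "inv h \<otimes> inv x \<otimes> h = inv (inv h \<otimes> x \<otimes> h)" if "x \<in> N" for x
    using that h by (simp add: m_assoc inv_mult_group)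
  have "subgroup {x \<in> N. inv h \<otimes> x \<otimes> h \<in> L} G"
  proof (rule subgroupI)
    show "{x \<in> N. inv h \<otimes> x \<otimes> h \<in> L} \<noteq> {}"
      using h by (auto intro!: exI[of _ \<one>])
  qed (auto simp: e1 e2)
  moreover have "n \<otimes> x \<otimes> inv n \<in> {x \<in> N. inv h \<otimes> x \<otimes> h \<in> L}"
    if n: "n \<in> N" and x: "x \<in> {x \<in> N. inv h \<otimes> x \<otimes> h \<in> L}" for n x
  proof -
    have "inv h \<otimes> (n \<otimes> x \<otimes> inv n) \<otimes> h
        = (inv h \<otimes> n \<otimes> h) \<otimes> (inv h \<otimes> x \<otimes> h) \<otimes> inv (inv h \<otimes> n \<otimes> h)"
      using n x h by (simp add: m_assoc inv_mult_cancel inv_mult_group)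
    then show ?thesis using c[OF N.inv_op_closed1[OF h n]] n x by auto
  qed
  ultimately show ?thesis using Ns by (simp add: normal_in_def)
qed

text \<open>Take \<open>N\<close> minimal among the normal subgroups containing a subnormal \<open>S\<close> that maps onto \<open>Q\<close>, and a maximal
  normal subgroup \<open>K\<close> of \<open>N\<close>. By minimality the intersection of \<open>S\<close> with all conjugates of \<open>K\<close> no longer
  maps onto \<open>Q\<close>, so intersecting with one conjugate after the other there is a last \<open>W\<close> that does.
  The next conjugate \<open>K'\<close> then satisfies \<open>N = W K'\<close>, and \<open>N / K' = W / (W \<inter> K')\<close> maps onto \<open>Q\<close>.\<close>

lemma simple_quotient_of_normal:
  assumes fin: "finite (carrier G)" and Q: "simple_group Q"
    and "subnormal S0" "maps_onto Q S0 f0"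
  shows "\<exists>N f. N \<lhd> G \<and> maps_onto Q N f"
proof -
  define P where "P N \<longleftrightarrow> N \<lhd> G \<and> (\<exists>S f. subnormal S \<and> S \<subseteq> N \<and> maps_onto Q S f)" for N
  have "P (carrier G)"
    unfolding P_def using assms(3,4) normal_in_carrier subnormal_imp_subgroup
    by (metis normal_in_def order_refl subgroup.subset subgroup_self m_closed inv_closed)
  then obtain N where PN: "P N" and Nmin: "\<And>M. P M \<Longrightarrow> card N \<le> card M"
    using ex_has_least_nat[of P "carrier G" card] by blast
  then obtain S f where N: "N \<lhd> G" and S: "subnormal S" "S \<subseteq> N" and f: "maps_onto Q S f"
    unfolding P_def by blast
  interpret Q: simple_group Q by fact
  interpret N: normal N G by fact
  have finN: "finite N" using fin N.subset finite_subset by blast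
  have Ssub: "subgroup S G" using S(1) by (rule subnormal_imp_subgroup)
  interpret S: subgroup S G by fact
  interpret f: group_hom "G\<lparr>carrier := S\<rparr>" Q f
    using maps_onto_group_hom[OF Q.is_group Ssub f] .
  have f1: "f \<one> = \<one>\<^bsub>Q\<^esub>" using f.hom_one by simp
  have Nne: "N \<noteq> {\<one>}"
  proof
    assume "N = {\<one>}"
    then have "S = {\<one>}" using S(2) S.one_closed by blast
    then have "carrier Q = {\<one>\<^bsub>Q\<^esub>}" using f f1 by (simp add: maps_onto_def)
    then show False using Q.simple_not_triv by blast
  qed
  define Z where "Z = {K. normal_in K N \<and> K \<noteq> N}"
  have "{\<one>} \<in> Z"
    using Nne triv_subgroup N.subgroup_axioms by (auto simp: Z_def normal_in_def)
  moreover have "Z \<subseteq> Pow N" by (auto simp: Z_def normal_in_def)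
  then have "finite Z" using finN finite_subset by blast
  ultimately obtain K where KZ: "K \<in> Z" and Kmax: "\<And>L. L \<in> Z \<Longrightarrow> K \<subseteq> L \<Longrightarrow> K = L"
    using finite_has_maximal[of Z] by blast
  have K: "normal_in K N" "K \<noteq> N" and KN: "K \<subseteq> N"
    using KZ by (auto simp: Z_def normal_in_def)
  define cj where "cj h = {x \<in> N. inv h \<otimes> x \<otimes> h \<in> K}" for h
  have cj_normal: "normal_in (cj h) N" if "h \<in> carrier G" for h
    unfolding cj_def using conj_normal_in[OF N K(1) that] .
  \<comment> \<open>Conjugating \<open>L\<close> back by \<open>h\<close> turns the claim into the
    maximality of \<open>K\<close>.\<close>
  have cj_max: "L = cj h \<or> L = N" if h: "h \<in> carrier G" and L: "normal_in L N" "cj h \<subseteq> L" for h L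
  proof -
    let ?L = "{x \<in> N. inv (inv h) \<otimes> x \<otimes> inv h \<in> L}"
    have e: "h \<otimes> (inv h \<otimes> x \<otimes> h) \<otimes> inv h = x" "inv h \<otimes> (h \<otimes> x \<otimes> inv h) \<otimes> h = x" if "x \<in> N" for x
      using that h by (simp_all add: m_assoc inv_mult_cancel)
    have LN: "L \<subseteq> N" using L(1) by (simp add: normal_in_def)
    have "normal_in ?L N" using conj_normal_in[OF N L(1) inv_closed[OF h]] .
    moreover have "K \<subseteq> ?L"
    proof
      fix x assume x: "x \<in> K"
      then have xN: "x \<in> N" using KN by blast
      have "h \<otimes> x \<otimes> inv h \<in> cj h"
        using e(2)[OF xN] x N.inv_op_closed2[OF h xN] by (simp add: cj_def)
      then show "x \<in> ?L" using L(2) xN h by auto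
    qed
    ultimately have "?L = K \<or> ?L = N" using Kmax[of ?L] by (auto simp: Z_def)
    then show ?thesis
    proof
      assume LK: "?L = K"
      have "L \<subseteq> cj h"
      proof
        fix x assume x: "x \<in> L"
        then have xN: "x \<in> N" using LN by blast
        have "inv h \<otimes> x \<otimes> h \<in> ?L"
          using e(1)[OF xN] x N.inv_op_closed1[OF h xN] h by simp
        then show "x \<in> cj h" using LK xN by (simp add: cj_def)
      qed
      then show ?thesis using L(2) by blast
    next
      assume LN': "?L = N"
      have "N \<subseteq> L"
      proof
        fix x assume xN: "x \<in> N"
        then have "inv h \<otimes> x \<otimes> h \<in> ?L" using LN' N.inv_op_closed1[OF h] by blast
        then show "x \<in> L" using e(1)[OF xN] h by simp
      qed
      then show ?thesis using LN by blast
    qed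
  qed
  define SF where "SF F = {x \<in> S. \<forall>h\<in>F. x \<in> cj h}" for F
  have SF_normal: "normal_in (SF F) S" if "F \<subseteq> carrier G" for F
  proof -
    have "finite F" using that fin finite_subset by blast
    then show ?thesis using that
    proof (induction F rule: finite_induct)
      case empty
      show ?case using Ssub by (simp add: SF_def normal_in_def)
    next
      case (insert h F)
      then have "normal_in (SF F \<inter> cj h) S"
        using normal_in_Int[OF _ cj_normal S(2)] by simp
      moreover have "SF F \<inter> cj h = SF (insert h F)" by (auto simp: SF_def)
      ultimately show ?case by simp
    qed
  qed
  have SF_carrier: "f ` SF (carrier G) \<noteq> carrier Q"
  proof
    assume a: "f ` SF (carrier G) = carrier Q"
    \<comment> \<open>\<open>M\<close> is the intersection of all conjugates of \<open>K\<close>,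
      hence normal in \<open>G\<close>; it lies in \<open>K\<close> and so is smaller than
      \<open>N\<close>.\<close>
    define M where "M = {x \<in> N. \<forall>h\<in>carrier G. x \<in> cj h}"
    have cjs: "subgroup (cj h) G" if "h \<in> carrier G" for h
      using cj_normal[OF that] by (simp add: normal_in_def)
    have Ms: "subgroup M G"
    proof (rule subgroupI)
      show "M \<subseteq> carrier G" using N.subset by (auto simp: M_def)
      show "M \<noteq> {}" using cjs subgroup.one_closed by (auto simp: M_def intro!: exI[of _ \<one>])
      show "\<And>a. a \<in> M \<Longrightarrow> inv a \<in> M"
        unfolding M_def by (auto intro: subgroup.m_inv_closed[OF cjs])
      show "\<And>a b. a \<in> M \<Longrightarrow> b \<in> M \<Longrightarrow> a \<otimes> b \<in> M"
        unfolding M_def by (auto intro: subgroup.m_closed[OF cjs])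
    qed
    have "g \<otimes> x \<otimes> inv g \<in> M" if g: "g \<in> carrier G" and x: "x \<in> M" for g x
    proof -
      have xN: "x \<in> N" using x by (simp add: M_def)
      have gN: "g \<otimes> x \<otimes> inv g \<in> N" using N.inv_op_closed2[OF g xN] .
      have "g \<otimes> x \<otimes> inv g \<in> cj h" if h: "h \<in> carrier G" for h
      proof -
        \<comment> \<open>Conjugation by \<open>g\<close> permutes the conjugates: membership for
          \<open>h\<close> comes from membership of \<open>x\<close> for
          \<open>inv g \<otimes> h\<close>.\<close>
        have "inv g \<otimes> h \<in> carrier G" using g h by simp
        then have "inv (inv g \<otimes> h) \<otimes> x \<otimes> (inv g \<otimes> h) \<in> K" using x by (auto simp: M_def cj_def)
        also have "inv (inv g \<otimes> h) \<otimes> x \<otimes> (inv g \<otimes> h) = inv h \<otimes> (g \<otimes> x \<otimes> inv g) \<otimes> h"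
          using g h xN by (simp add: m_assoc inv_mult_group)
        finally show ?thesis using gN by (simp add: cj_def)
      qed
      then show ?thesis using gN by (simp add: M_def)
    qed
    then have Mn: "M \<lhd> G" using Ms by (simp add: normal_inv_iff)
    have "SF (carrier G) \<subseteq> M" using S(2) by (auto simp: M_def SF_def)
    moreover have "subnormal (SF (carrier G))" using subnormal_step[OF S(1) SF_normal] by simp
    moreover have "maps_onto Q (SF (carrier G)) f"
      using maps_onto_subset[OF f _ a] by (auto simp: SF_def)
    ultimately have "P M" unfolding P_def using Mn by blast
    then have "card N \<le> card M" by (rule Nmin)
    moreover have "M \<subseteq> K"
    proof
      fix x assume "x \<in> M"
      then have "x \<in> cj \<one>" "x \<in> N" by (auto simp: M_def)
      then show "x \<in> K" by (simp add: cj_def)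
    qed
    then have "M \<subset> N" using KN K(2) by blast
    ultimately show False using psubset_card_mono[OF finN] by (metis leD)
  qed
  \<comment> \<open>A maximal \<open>F\<close> here yields the last intersection that still maps
    onto \<open>Q\<close>; any \<open>h\<close> outside it spoils surjectivity.\<close>
  define Y where "Y = {F. F \<subseteq> carrier G \<and> f ` SF F = carrier Q}"
  have "{} \<in> Y" using f by (simp add: Y_def SF_def maps_onto_def)
  moreover have "finite Y" using fin by (simp add: Y_def)
  ultimately obtain F where FY: "F \<in> Y" and Fmax: "\<And>E. E \<in> Y \<Longrightarrow> F \<subseteq> E \<Longrightarrow> F = E"
    using finite_has_maximal[of Y] by blast
  have F: "F \<subseteq> carrier G" "f ` SF F = carrier Q" using FY by (auto simp: Y_def)
  have "F \<noteq> carrier G" using F(2) SF_carrier by metis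
  then obtain h where h: "h \<in> carrier G" "h \<notin> F" using F(1) by auto
  have hF: "insert h F \<subseteq> carrier G" using h(1) F(1) by simp
  have "insert h F \<notin> Y" using Fmax[of "insert h F"] h(2) by auto
  then have "f ` SF (insert h F) \<noteq> carrier Q" using hF by (simp add: Y_def)
  then have triv: "f ` SF (insert h F) = {\<one>\<^bsub>Q\<^esub>}"
    using maps_onto_normal_in[OF Q f SF_normal[OF hF]] by blast
  define W where "W = SF F"
  define K' where "K' = cj h"
  have XK: "W \<inter> K' = SF (insert h F)" by (auto simp: W_def K'_def SF_def)
  have Xn: "normal_in W S" unfolding W_def using SF_normal[OF F(1)] .
  then have XS: "W \<subseteq> S" and Xs: "subgroup W G" by (auto simp: normal_in_def)
  have K'n: "normal_in K' N" unfolding K'_def using cj_normal[OF h(1)] .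
  have Xsub: "subnormal W" using subnormal_step[OF S(1) Xn] .
  have "N \<subseteq> (\<Union>x\<in>W \<inter> N. \<Union>k\<in>K'. {x \<otimes> k})"
  proof (rule ccontr)
    assume "\<not> ?thesis"
    then have "W \<inter> N \<subseteq> K'"
      using subnormal_dichotomy[OF Xsub N K'n] cj_max[OF h(1)] K'_def by blast
    then have "W \<inter> K' = W" using XS S(2) by blast
    then have "f ` SF F = {\<one>\<^bsub>Q\<^esub>}" using triv XK by (simp add: W_def)
    then show False using F(2) Q.simple_not_triv by simp
  qed
  then have dec: "\<exists>x. x \<in> W \<and> (\<exists>k\<in>K'. n = x \<otimes> k)" if "n \<in> N" for n
    using that by blast
  interpret W: subgroup W G by fact
  interpret K': subgroup K' G using K'n by (simp add: normal_in_def)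
  have cK: "\<And>a b. b \<in> N \<Longrightarrow> a \<in> K' \<Longrightarrow> b \<otimes> a \<otimes> inv b \<in> K'" and K'N: "K' \<subseteq> N"
    using K'n by (auto simp: normal_in_def)
  \<comment> \<open>The map \<open>x \<otimes> k \<mapsto> f x\<close>, well defined because
    \<open>f\<close> is trivial on \<open>W \<inter> K'\<close>.\<close>
  define g where "g n = f (SOME x. x \<in> W \<and> (\<exists>k\<in>K'. n = x \<otimes> k))" for n
  have fm: "f (x \<otimes> y) = f x \<otimes>\<^bsub>Q\<^esub> f y" if "x \<in> W" "y \<in> W" for x y
    using f that XS by (auto simp: maps_onto_def)
  have g: "g (x \<otimes> k) = f x" if x: "x \<in> W" and k: "k \<in> K'" for x k
  proof -
    have "\<exists>x'. x' \<in> W \<and> (\<exists>k'\<in>K'. x \<otimes> k = x' \<otimes> k')" using x k by blast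
    from someI_ex[OF this] obtain x' k' where x': "x' \<in> W" "k' \<in> K'" "x \<otimes> k = x' \<otimes> k'"
      and gx: "g (x \<otimes> k) = f x'" unfolding g_def by blast
    have "inv x' \<otimes> x = inv x' \<otimes> (x \<otimes> k) \<otimes> inv k" using x k x'(1) by (simp add: m_assoc)
    also have "\<dots> = inv x' \<otimes> (x' \<otimes> k') \<otimes> inv k" using x'(3) by simp
    also have "\<dots> = k' \<otimes> inv k" using x' k by (simp add: inv_mult_cancel)
    finally have eq: "inv x' \<otimes> x = k' \<otimes> inv k" .
    have "inv x' \<otimes> x \<in> W" using x x' by simp
    moreover have "inv x' \<otimes> x \<in> K'" using eq x' k by simp
    ultimately have "f (inv x' \<otimes> x) = \<one>\<^bsub>Q\<^esub>" using triv XK by blast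
    moreover have "f x = f (x' \<otimes> (inv x' \<otimes> x))" using x x' by (simp add: inv_mult_cancel)
    moreover have "f x' \<in> carrier Q" using x' F(2) by (auto simp: W_def)
    ultimately have "f x = f x'" using fm[of x' "inv x' \<otimes> x"] x x' by simp
    then show ?thesis using gx by simp
  qed
  have "maps_onto Q N g"
    unfolding maps_onto_def
  proof (intro conjI ballI)
    fix m n assume "m \<in> N" "n \<in> N"
    then obtain x k y l where x: "x \<in> W" "k \<in> K'" "m = x \<otimes> k" and y: "y \<in> W" "l \<in> K'" "n = y \<otimes> l"
      using dec by meson
    have "m \<otimes> n = (x \<otimes> y) \<otimes> ((inv y \<otimes> k \<otimes> inv (inv y)) \<otimes> l)"
      using x y by (simp add: m_assoc inv_mult_cancel)
    moreover have "inv y \<in> N" using y XS S(2) by auto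
    then have "inv y \<otimes> k \<otimes> inv (inv y) \<in> K'" using cK x by blast
    ultimately have "g (m \<otimes> n) = f (x \<otimes> y)" using g x y by simp
    then show "g (m \<otimes> n) = g m \<otimes>\<^bsub>Q\<^esub> g n" using fm x y g by simp
  next
    show "g ` N = carrier Q"
    proof (intro equalityI subsetI)
      fix q assume "q \<in> g ` N"
      then obtain n where "n \<in> N" "q = g n" by blast
      then obtain x where "x \<in> W" "q = f x" using dec g by metis
      then show "q \<in> carrier Q" using F(2) by (auto simp: W_def)
    next
      fix q assume "q \<in> carrier Q"
      then obtain x where x: "x \<in> W" "q = f x" using F(2) by (auto simp: W_def)
      then have "g x = q" using g[of x \<one>] by simp
      moreover have "x \<in> N" using x XS S(2) by blast
      ultimately show "q \<in> g ` N" by blast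
    qed
  qed
  then show ?thesis using N by blast
qed

end

section \<open>Words in finite groups with an alternating composition factor\<close>

text \<open>Swapping \<open>i\<close> and \<open>j\<close> alone is odd; the third point
  \<open>l\<close> absorbs a second transposition that restores the parity.\<close>

lemma three_cycle_alt_group:
  assumes "i \<in> {1..k}" "j \<in> {1..k}" "l \<in> {1..k}" "i \<noteq> j" "j \<noteq> l" "i \<noteq> l"
  shows "\<exists>\<sigma>\<in>carrier (alt_group k). \<sigma> i = j \<and> (\<forall>m. m \<notin> {i, j, l} \<longrightarrow> \<sigma> m = m)"
proof (rule bexI)
  let ?s = "Transposition.transpose i j \<circ> Transposition.transpose j l"
  have "?s permutes {1..k}"
    using assms by (intro permutes_compose permutes_swap_id) auto
  moreover have "evenperm ?s"
    using assms by (simp add: evenperm_comp permutation_swap_id evenperm_swap)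
  ultimately show "?s \<in> carrier (alt_group k)" by (simp add: alt_group_carrier)
  show "?s i = j \<and> (\<forall>m. m \<notin> {i, j, l} \<longrightarrow> ?s m = m)"
    using assms by (auto simp: Transposition.transpose_def)
qed

text \<open>The set \<open>cell h i\<close> is a left coset of \<open>{n \<in> N. f n 1 = 1}\<close>, labelled so that \<open>N\<close> permutes the cells
  with the same \<open>h\<close> through \<open>f\<close> twisted by conjugation with \<open>h\<close>.\<close>

lemma (in group) alternating_action_alt_quotient:
  assumes fin: "finite (carrier G)" and N: "N \<lhd> G" and f: "maps_onto (alt_group k) N f" and k: "3 \<le> k"
  defines "cell \<equiv> \<lambda>h i. (\<lambda>n. h \<otimes> n) ` {n \<in> N. f n 1 = (i::nat)}"
  shows "alternating_action G N {cell h i | h i. h \<in> carrier G \<and> i \<in> {1..k}} (\<lambda>x C. l_coset G x C) k"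
proof -
  interpret N: normal N G by fact
  have fN: "f n \<in> carrier (alt_group k)" if "n \<in> N" for n
    using f that by (auto simp: maps_onto_def)
  have fperm: "f n permutes {1..k}" if "n \<in> N" for n
    using fN[OF that] by (simp add: alt_group_carrier)
  have fmult: "f (m \<otimes> n) = f m \<circ> f n" if "m \<in> N" "n \<in> N" for m n
    using f that by (simp add: maps_onto_def alt_group_mult)
  have surj: "\<exists>n\<in>N. f n = \<sigma>" if "\<sigma> \<in> carrier (alt_group k)" for \<sigma>
  proof -
    have "\<sigma> \<in> f ` N" using f that by (simp add: maps_onto_def)
    then show ?thesis by (auto simp: image_iff)
  qed
  have trans: "\<exists>n\<in>N. f n i = j" if ij: "i \<in> {1..k}" "j \<in> {1..k}" for i j
  proof (cases "i = j")
    case True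
    obtain n where "n \<in> N" "f n = id"
      using surj[of id] by (auto simp: alt_group_carrier permutes_id evenperm_id)
    then show ?thesis using True by (intro bexI[of _ n]) auto
  next
    case False
    have "card {i, j} < card {1..k}" using False k by simp
    then have "\<not> {1..k} \<subseteq> {i, j}" using card_mono[of "{i, j}" "{1..k}"] by auto
    then obtain l where "l \<in> {1..k}" "l \<noteq> i" "l \<noteq> j" by blast
    then show ?thesis using three_cycle_alt_group[OF ij(1,2), of l] False surj by blast
  qed
  have finv: "f (inv n) (f n i) = i" if n: "n \<in> N" for n i
  proof -
    \<comment> \<open>\<open>f\<close> is given only as multiplicative on \<open>N\<close>;
      \<open>f \<one>\<close> is idempotent and injective, hence the identity.\<close>
    have "f \<one> (f \<one> j) = f \<one> j" for j using fmult[of \<one> \<one>] by (simp add: fun_eq_iff)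
    then have "f \<one> i = i"
      using injD[OF permutes_inj[OF fperm[OF N.one_closed]]] by blast
    then show ?thesis using fmult[of "inv n" n] n by (simp add: fun_eq_iff)
  qed
  have cell_sub: "cell h i \<subseteq> carrier G" if "h \<in> carrier G" for h i
    using that by (auto simp: cell_def)
  have act_cell: "l_coset G x (cell h i) = cell (x \<otimes> h) i" if "x \<in> carrier G" "h \<in> carrier G" for x h i
    using that by (force simp: cell_def l_coset_def m_assoc)
  \<comment> \<open>All representatives of the coset of \<open>h\<close> modulo \<open>N\<close>
    give the same cells up to relabelling; together with \<open>act_cell\<close> this turns left
    multiplication by \<open>N\<close> into a permutation of labels.\<close>
  have cell_shift: "cell (h \<otimes> m) i = cell h (f m i)" if h: "h \<in> carrier G" and m: "m \<in> N" for h m i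
  proof (intro equalityI subsetI)
    fix y assume "y \<in> cell (h \<otimes> m) i"
    then obtain n where n: "n \<in> N" "f n 1 = i" "y = h \<otimes> m \<otimes> n" by (auto simp: cell_def)
    then have "y = h \<otimes> (m \<otimes> n)" "f (m \<otimes> n) 1 = f m i" "m \<otimes> n \<in> N"
      using h m fmult by (auto simp: m_assoc)
    then show "y \<in> cell h (f m i)" by (auto simp: cell_def)
  next
    fix y assume "y \<in> cell h (f m i)"
    then obtain n where n: "n \<in> N" "f n 1 = f m i" "y = h \<otimes> n" by (auto simp: cell_def)
    have "y = h \<otimes> m \<otimes> (inv m \<otimes> n)" using n h m by (simp add: m_assoc inv_mult_cancel)
    moreover have "f (inv m \<otimes> n) 1 = i" using fmult[of "inv m" n] n m finv by simp
    moreover have "inv m \<otimes> n \<in> N" using n m by simp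
    ultimately show "y \<in> cell (h \<otimes> m) i" by (auto simp: cell_def)
  qed
  have cell_inj: "i = j" if eq: "cell h i = cell h j" and h: "h \<in> carrier G" and i: "i \<in> {1..k}" for h i j
  proof -
    obtain n where n: "n \<in> N" "f n 1 = i" using trans[of 1 i] i k by auto
    then have "h \<otimes> n \<in> cell h j" using eq by (auto simp: cell_def)
    then obtain m where m: "m \<in> N" "f m 1 = j" "h \<otimes> n = h \<otimes> m" by (auto simp: cell_def)
    then have "n = m" using h n by simp
    then show ?thesis using n m by simp
  qed
  have orbit: "(\<lambda>n. l_coset G n (cell h i)) ` N = cell h ` {1..k}"
    if h: "h \<in> carrier G" and i: "i \<in> {1..k}" for h i
  proof (intro equalityI subsetI)
    fix C assume "C \<in> (\<lambda>n. l_coset G n (cell h i)) ` N"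
    then obtain n where n: "n \<in> N" "C = l_coset G n (cell h i)" by blast
    have m: "inv h \<otimes> n \<otimes> h \<in> N" using N.inv_op_closed1[OF h n(1)] .
    have "C = cell (n \<otimes> h) i" using n h act_cell by simp
    \<comment> \<open>Here the twist arises: the labels are permuted by the conjugate of
      \<open>n\<close> by \<open>h\<close>, not by \<open>n\<close>.\<close>
    also have "n \<otimes> h = h \<otimes> (inv h \<otimes> n \<otimes> h)" using n h by (simp add: m_assoc inv_mult_cancel)
    also have "cell \<dots> i = cell h (f (inv h \<otimes> n \<otimes> h) i)" using cell_shift[OF h m] .
    finally show "C \<in> cell h ` {1..k}"
      using permutes_in_image[OF fperm[OF m]] i by blast
  next
    fix C assume "C \<in> cell h ` {1..k}"
    then obtain j where j: "j \<in> {1..k}" "C = cell h j" by blast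
    obtain m where m: "m \<in> N" "f m i = j" using trans[OF i j(1)] by blast
    have n: "h \<otimes> m \<otimes> inv h \<in> N" using N.inv_op_closed2[OF h m(1)] .
    have "l_coset G (h \<otimes> m \<otimes> inv h) (cell h i) = cell (h \<otimes> m \<otimes> inv h \<otimes> h) i"
      using act_cell n h by simp
    also have "h \<otimes> m \<otimes> inv h \<otimes> h = h \<otimes> m" using h m by (simp add: m_assoc)
    also have "cell (h \<otimes> m) i = C" using cell_shift[OF h m(1)] m j by simp
    finally show "C \<in> (\<lambda>n. l_coset G n (cell h i)) ` N" using n by blast
  qed
  show ?thesis
  proof (rule alternating_action.intro[OF group_axioms alternating_action_axioms.intro])
    show "finite (carrier G)" by fact
    show "N \<lhd> G" by fact
  next
    fix x p assume x: "x \<in> carrier G" and "p \<in> {cell h i | h i. h \<in> carrier G \<and> i \<in> {1..k}}"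
    then obtain h i where p: "p = cell h i" "h \<in> carrier G" "i \<in> {1..k}" by blast
    show "l_coset G x p \<in> {cell h i | h i. h \<in> carrier G \<and> i \<in> {1..k}}"
      using act_cell[OF x p(2)] p x by (intro CollectI exI[of _ "x \<otimes> h"] exI[of _ i]) simp
    fix y assume y: "y \<in> carrier G"
    show "l_coset G (x \<otimes> y) p = l_coset G x (l_coset G y p)"
      using x y p lcos_m_assoc[OF cell_sub] by simp
  next
    fix p assume "p \<in> {cell h i | h i. h \<in> carrier G \<and> i \<in> {1..k}}"
    then obtain h i where p: "p = cell h i" "h \<in> carrier G" "i \<in> {1..k}" by blast
    show "l_coset G \<one> p = p" using p lcos_mult_one[OF cell_sub] by simp
    have "inj_on (cell h) {1..k}" using cell_inj p(2) by (meson inj_onI)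
    then show "card ((\<lambda>n. l_coset G n p) ` N) = k"
      unfolding p(1) orbit[OF p(2,3)] by (simp add: card_image)
    fix q r assume q: "q \<in> (\<lambda>n. l_coset G n p) ` N" and r: "r \<in> (\<lambda>n. l_coset G n p) ` N"
      and ne: "p \<noteq> q" "q \<noteq> r" "p \<noteq> r"
    note orb = orbit[OF p(2,3), folded p(1)]
    obtain j where j: "j \<in> {1..k}" "q = cell h j" using q orb by blast
    obtain l where l: "l \<in> {1..k}" "r = cell h l" using r orb by blast
    obtain \<sigma> where s: "\<sigma> \<in> carrier (alt_group k)" "\<sigma> i = j" "\<And>m. m \<notin> {i, j, l} \<Longrightarrow> \<sigma> m = m"
      using three_cycle_alt_group[OF p(3) j(1) l(1)] ne p j l by blast
    obtain m where m: "m \<in> N" "f m = \<sigma>" using surj s by blast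
    have d: "h \<otimes> m \<otimes> inv h \<in> N" using N.inv_op_closed2[OF p(2) m(1)] .
    have dact: "l_coset G (h \<otimes> m \<otimes> inv h) (cell h t) = cell h (\<sigma> t)" for t
    proof -
      have "l_coset G (h \<otimes> m \<otimes> inv h) (cell h t) = cell (h \<otimes> m \<otimes> inv h \<otimes> h) t"
        using act_cell d p(2) by simp
      also have "h \<otimes> m \<otimes> inv h \<otimes> h = h \<otimes> m" using p(2) m by (simp add: m_assoc)
      finally show ?thesis using cell_shift[OF p(2) m(1)] m by simp
    qed
    show "\<exists>d\<in>N. l_coset G d p = q \<and> (\<forall>z\<in>(\<lambda>n. l_coset G n p) ` N. z \<notin> {p, q, r} \<longrightarrow> l_coset G d z = z)"
    proof (intro bexI[OF _ d] conjI ballI impI)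
      show "l_coset G (h \<otimes> m \<otimes> inv h) p = q" using dact p j s by simp
      fix z assume z: "z \<in> (\<lambda>n. l_coset G n p) ` N" "z \<notin> {p, q, r}"
      then obtain t where t: "t \<in> {1..k}" "z = cell h t" using orb by blast
      then have "t \<notin> {i, j, l}" using z p j l by blast
      then show "l_coset G (h \<otimes> m \<otimes> inv h) z = z" using dact t s by simp
    qed
  qed
qed

section \<open>From composition factors to normal subgroups and solution counts\<close>

lemma (in group) composition_series_subnormal:
  assumes L: "composition_series G L" and "i < length L"
  shows "subnormal (L ! i)"
  using assms(2)
proof (induction i)
  case 0
  then show ?case using L subnormal_carrier by (simp add: composition_series_def hd_conv_nth)
next
  case (Suc i)
  then have s: "subnormal (L ! i)" by simp
  have "L ! Suc i \<lhd> G\<lparr>carrier := L ! i\<rparr>"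
    using L Suc.prems by (simp add: composition_series_def)
  then show ?case using subnormal_step[OF s] normal_normal_in[OF subnormal_imp_subgroup[OF s]] by blast
qed

text \<open>The minimality argument needs a simple target, and it is the factor of the series that
  is known to be simple; the isomorphism to \<open>Q\<close> is composed afterwards.\<close>

lemma (in group) composition_factor_quotient_of_normal:
  assumes fin: "finite (carrier G)" and c: "composition_factor G Q"
  shows "\<exists>N f. N \<lhd> G \<and> maps_onto Q N f"
proof -
  obtain L i g where L: "composition_series G L" and i: "i < length L - 1"
    and g: "g \<in> iso (G\<lparr>carrier := L ! i\<rparr> Mod (L ! Suc i)) Q"
    using c by (auto simp: composition_factor_def is_iso_def)
  let ?S = "L ! i" and ?R = "L ! Suc i"
  have S: "subnormal ?S" using composition_series_subnormal[OF L] i by simp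
  have R: "?R \<lhd> G\<lparr>carrier := ?S\<rparr>" and sm: "simple_group (G\<lparr>carrier := ?S\<rparr> Mod ?R)"
    using L i by (auto simp: composition_series_def)
  let ?p = "\<lambda>x. ?R #> x"
  have "?p \<in> hom (G\<lparr>carrier := ?S\<rparr>) (G\<lparr>carrier := ?S\<rparr> Mod ?R)"
    using normal.r_coset_hom_Mod[OF R] by simp
  then have "maps_onto (G\<lparr>carrier := ?S\<rparr> Mod ?R) ?S ?p"
    by (auto simp: maps_onto_def hom_def carrier_FactGroup)
  from simple_quotient_of_normal[OF fin sm S this]
  obtain N f where N: "N \<lhd> G" and f: "maps_onto (G\<lparr>carrier := ?S\<rparr> Mod ?R) N f" by blast
  have "maps_onto Q N (g \<circ> f)"
    unfolding maps_onto_def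
  proof (intro conjI ballI)
    fix x y assume "x \<in> N" "y \<in> N"
    then have "f x \<in> carrier (G\<lparr>carrier := ?S\<rparr> Mod ?R)" "f y \<in> carrier (G\<lparr>carrier := ?S\<rparr> Mod ?R)"
      "f (x \<otimes> y) = f x \<otimes>\<^bsub>G\<lparr>carrier := ?S\<rparr> Mod ?R\<^esub> f y"
      using f by (auto simp: maps_onto_def)
    then show "(g \<circ> f) (x \<otimes> y) = (g \<circ> f) x \<otimes>\<^bsub>Q\<^esub> (g \<circ> f) y"
      using g unfolding iso_def by (simp add: hom_mult del: mult_FactGroup)
  next
    have "g ` carrier (G\<lparr>carrier := ?S\<rparr> Mod ?R) = carrier Q"
      using g by (simp add: iso_def bij_betw_def)
    then show "(g \<circ> f) ` N = carrier Q" using f by (simp only: maps_onto_def image_comp[symmetric])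
  qed
  then show ?thesis using N by blast
qed

lemma (in group) card_eval_word_one_alt_factor:
  assumes fin: "finite (carrier G)" and c: "composition_factor G (alt_group k)"
    and w: "\<forall>(i, c)\<in>set w. i < n" "reduced_word w" "w \<noteq> []"
    and s: "2 \<le> s" and k: "2 * length w + 3 + s + (2 * s) ^ Suc (length w) \<le> k"
  shows "card {x \<in> {..<n} \<rightarrow>\<^sub>E carrier G. eval_word G x w = \<one>} * s
    \<le> (length w)\<^sup>2 * card ({..<n} \<rightarrow>\<^sub>E carrier G)"
proof -
  obtain N f where N: "N \<lhd> G" and f: "maps_onto (alt_group k) N f"
    using composition_factor_quotient_of_normal[OF fin c] by blast
  have k3: "3 \<le> k" using k by linarith
  let ?cell = "\<lambda>h i. (\<lambda>n. h \<otimes> n) ` {n \<in> N. f n 1 = (i::nat)}"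
  interpret A: alternating_action G N "{?cell h i | h i. h \<in> carrier G \<and> i \<in> {1..k}}" "\<lambda>x C. l_coset G x C" k
    using alternating_action_alt_quotient[OF fin N f k3] .
  have "{?cell h i | h i. h \<in> carrier G \<and> i \<in> {1..k}} \<noteq> {}"
    using one_closed k3 by fastforce
  from A.card_eval_word_one[OF this w s k] show ?thesis by (simp add: A.tuples_def)
qed

section \<open>Haar measure\<close>

lemma openin_r_coset:
  assumes T: "topological_group G T" and K: "K \<subseteq> carrier G" "openin T K" and a: "a \<in> carrier G"
  shows "openin T (K #>\<^bsub>G\<^esub> a)"
proof -
  have G: "group G" and top: "topspace T = carrier G"
    and c: "continuous_map (prod_topology T T) T (\<lambda>(x, y). x \<otimes>\<^bsub>G\<^esub> y)"
    using T by (auto simp: topological_group_def)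
  interpret group G by fact
  have "continuous_map T (prod_topology T T) (\<lambda>x. (x, inv\<^bsub>G\<^esub> a))"
    using a top by (intro continuous_map_pairedI) auto
  from continuous_map_compose[OF this c]
  have "continuous_map T T (\<lambda>x. x \<otimes>\<^bsub>G\<^esub> inv\<^bsub>G\<^esub> a)" by (simp add: o_def)
  from openin_continuous_map_preimage[OF this K(2)]
  have "openin T {x \<in> carrier G. x \<otimes>\<^bsub>G\<^esub> inv\<^bsub>G\<^esub> a \<in> K}" by (simp add: top)
  also have "{x \<in> carrier G. x \<otimes>\<^bsub>G\<^esub> inv\<^bsub>G\<^esub> a \<in> K} = K #>\<^bsub>G\<^esub> a"
  proof (intro equalityI subsetI)
    fix x assume x: "x \<in> {x \<in> carrier G. x \<otimes>\<^bsub>G\<^esub> inv\<^bsub>G\<^esub> a \<in> K}"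
    then have "x = x \<otimes>\<^bsub>G\<^esub> inv\<^bsub>G\<^esub> a \<otimes>\<^bsub>G\<^esub> a" using a by (simp add: m_assoc)
    then show "x \<in> K #>\<^bsub>G\<^esub> a" using x by (auto simp: r_coset_def)
  next
    fix x assume "x \<in> K #>\<^bsub>G\<^esub> a"
    then obtain k where "k \<in> K" "x = k \<otimes>\<^bsub>G\<^esub> a" by (auto simp: r_coset_def)
    then show "x \<in> {x \<in> carrier G. x \<otimes>\<^bsub>G\<^esub> inv\<^bsub>G\<^esub> a \<in> K}"
      using a K(1) by (auto simp: m_assoc)
  qed
  finally show ?thesis .
qed

text \<open>The cosets form a disjoint open cover, so no finite subcover can omit one of
  them.\<close>

lemma finite_rcosets_open:
  assumes T: "topological_group G T" and cpt: "compact_space T"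
    and K: "subgroup K G" "openin T K"
  shows "finite (rcosets\<^bsub>G\<^esub> K)"
proof -
  have G: "group G" and top: "topspace T = carrier G"
    using T by (auto simp: topological_group_def)
  interpret group G by fact
  have sub: "K \<subseteq> carrier G" using K(1) by (rule subgroup.subset)
  have "\<forall>U\<in>rcosets\<^bsub>G\<^esub> K. openin T U"
    using openin_r_coset[OF T sub K(2)] by (auto simp: RCOSETS_def)
  moreover have "topspace T \<subseteq> \<Union>(rcosets\<^bsub>G\<^esub> K)" using rcosets_part_G[OF K(1)] top by simp
  ultimately obtain F where F: "finite F" "F \<subseteq> rcosets\<^bsub>G\<^esub> K" "carrier G \<subseteq> \<Union>F"
    using cpt top unfolding compact_space_alt by metis
  have "rcosets\<^bsub>G\<^esub> K \<subseteq> F"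
  proof
    fix c assume c: "c \<in> rcosets\<^bsub>G\<^esub> K"
    then obtain x where x: "x \<in> carrier G" "c = K #>\<^bsub>G\<^esub> x" by (auto simp: RCOSETS_def)
    then have "x \<in> c" using rcos_self[OF x(1) K(1)] by simp
    moreover obtain d where d: "d \<in> F" "x \<in> d" using F(3) x by blast
    moreover have "d \<in> rcosets\<^bsub>G\<^esub> K" using d F by blast
    ultimately have "c = d" using c rcos_disjoint[OF K(1)] by (auto simp: pairwise_def disjnt_iff)
    then show "c \<in> F" using d by simp
  qed
  then show ?thesis using F(1) finite_subset by blast
qed

lemma (in normal) eval_word_Mod:
  assumes "\<forall>(i, b)\<in>set w. x i \<in> carrier G \<and> y i = H #> x i"
  shows "eval_word (G Mod H) y w = H #> eval_word G x w"
  using assms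
proof (induction w)
  case Nil
  then show ?case using coset_mult_one[OF subset] by simp
next
  case (Cons a w)
  obtain i b where a: "a = (i, b)" by (cases a)
  have x: "x i \<in> carrier G" "y i = H #> x i" using Cons.prems a by auto
  have e: "eval_word G x w \<in> carrier G"
    using Cons.prems by (intro eval_word_closed) auto
  have IH: "eval_word (G Mod H) y w = H #> eval_word G x w"
    using Cons by auto
  have inv: "inv\<^bsub>G Mod H\<^esub> (y i) = H #> inv (x i)"
    using x rcos_inv[OF x(1)] inv_FactGroup[of "y i"] by (simp add: carrier_FactGroup)
  show ?case
    using a IH x e inv rcos_sum[OF x(1) e] rcos_sum[OF inv_closed[OF x(1)] e] by simp
qed

text \<open>The boxes are translates of one another and partition the whole space, so the measure of
  a union of boxes is the proportion of boxes used.\<close>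

lemma measure_cosets_box:
  assumes T: "topological_group G T" and cpt: "compact_space T"
    and K: "K \<lhd> G" "openin T K"
    and \<nu>: "haar_measure (product_topology (\<lambda>_. T) {..<n}) (power_group n G) \<nu>"
    and Y: "Y \<subseteq> ({..<n} \<rightarrow>\<^sub>E rcosets\<^bsub>G\<^esub> K)"
  shows "(\<Union>y\<in>Y. PiE {..<n} y) \<in> sets \<nu>"
    and "measure \<nu> (\<Union>y\<in>Y. PiE {..<n} y) * card ({..<n} \<rightarrow>\<^sub>E rcosets\<^bsub>G\<^esub> K) = card Y"
proof -
  have G: "group G" and top: "topspace T = carrier G"
    using T by (auto simp: topological_group_def)
  interpret K: normal K G by fact
  interpret \<nu>: prob_space \<nu> using \<nu> by (simp add: haar_measure_def)
  let ?R = "rcosets\<^bsub>G\<^esub> K"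
  let ?Z = "{..<n} \<rightarrow>\<^sub>E ?R"
  have finR: "finite ?R" using finite_rcosets_open[OF T cpt K.subgroup_axioms K(2)] .
  then have finZ: "finite ?Z" by (simp add: finite_PiE)
  have Rsub: "c \<subseteq> carrier G" if "c \<in> ?R" for c
    using that K.rcosets_carrier[OF G] by blast
  have space: "space \<nu> = ({..<n} \<rightarrow>\<^sub>E carrier G)"
    using \<nu> top by (simp add: haar_measure_def)
  have sets: "sets \<nu> = borel_sets_of (product_topology (\<lambda>_. T) {..<n})"
    using \<nu> by (simp add: haar_measure_def)
  have R_open: "openin T c" if "c \<in> ?R" for c
    using openin_r_coset[OF T K.subset K(2)] that by (auto simp: RCOSETS_def)
  have box: "PiE {..<n} y \<in> sets \<nu>" if "y \<in> ?Z" for y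
  proof -
    have "openin (product_topology (\<lambda>_. T) {..<n}) (PiE {..<n} y)"
      using that R_open by (auto simp: openin_PiE PiE_iff)
    then show ?thesis unfolding sets borel_sets_of_def by (intro sigma_sets.Basic) simp
  qed
  have eq: "measure \<nu> (PiE {..<n} y) = measure \<nu> (PiE {..<n} (\<lambda>_. K))" if y: "y \<in> ?Z" for y
  proof -
    define g where "g = (\<lambda>i\<in>{..<n}. SOME x. x \<in> carrier G \<and> y i = K #>\<^bsub>G\<^esub> x)"
    have gi: "g i \<in> carrier G \<and> y i = K #>\<^bsub>G\<^esub> g i" if i: "i < n" for i
    proof -
      have "\<exists>x. x \<in> carrier G \<and> y i = K #>\<^bsub>G\<^esub> x"
        using y i by (auto simp: PiE_iff RCOSETS_def)
      from someI_ex[OF this] show ?thesis using i by (simp add: g_def)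
    qed
    \<comment> \<open>Left invariance moves left cosets, while the quotient consists of right
      cosets; normality of \<open>K\<close> identifies the two.\<close>
    have gl: "y i = g i <#\<^bsub>G\<^esub> K" if "i < n" for i
      using gi[OF that] K.coset_eq by simp
    have gc: "g \<in> carrier (power_group n G)"
      using gi by (auto simp: power_group_def g_def)
    have img: "(\<lambda>x. g \<otimes>\<^bsub>power_group n G\<^esub> x) ` (PiE {..<n} (\<lambda>_. K)) = PiE {..<n} y"
    proof (intro equalityI subsetI)
      fix z assume "z \<in> (\<lambda>x. g \<otimes>\<^bsub>power_group n G\<^esub> x) ` (PiE {..<n} (\<lambda>_. K))"
      then show "z \<in> PiE {..<n} y" using gl by (auto simp: power_group_def l_coset_def PiE_iff)
    next
      fix z assume z: "z \<in> PiE {..<n} y"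
      define x where "x = (\<lambda>i\<in>{..<n}. inv\<^bsub>G\<^esub> (g i) \<otimes>\<^bsub>G\<^esub> z i)"
      have xi: "x i \<in> K \<and> g i \<otimes>\<^bsub>G\<^esub> x i = z i" if i: "i < n" for i
      proof -
        have "z i \<in> g i <#\<^bsub>G\<^esub> K" using z gl i by auto
        then obtain k where k: "k \<in> K" "z i = g i \<otimes>\<^bsub>G\<^esub> k" by (auto simp: l_coset_def)
        then have "x i = k" using i gi[OF i] by (simp add: x_def K.inv_mult_cancel)
        then show ?thesis using k by simp
      qed
      have "z = g \<otimes>\<^bsub>power_group n G\<^esub> x"
        using xi z by (auto simp: power_group_def PiE_iff extensional_def restrict_def)
      moreover have "x \<in> PiE {..<n} (\<lambda>_. K)" using xi by (auto simp: x_def)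
      ultimately show "z \<in> (\<lambda>x. g \<otimes>\<^bsub>power_group n G\<^esub> x) ` (PiE {..<n} (\<lambda>_. K))" by blast
    qed
    have K_box: "PiE {..<n} (\<lambda>_. K) \<in> sets \<nu>"
    proof -
      \<comment> \<open>Functions in \<open>?Z\<close> take the default value outside
        \<open>{..<n}\<close>, so the constant function must be restricted to belong to it.\<close>
      have "restrict (\<lambda>_. K) {..<n} \<in> ?Z"
        using K.subgroup_in_rcosets[OF G] by auto
      moreover have "PiE {..<n} (restrict (\<lambda>_. K) {..<n}) = PiE {..<n} (\<lambda>_. K)"
        by (intro PiE_cong) simp
      ultimately show ?thesis using box by metis
    qed
    then show ?thesis
      using \<nu> gc img unfolding haar_measure_def measure_def by metis
  qed
  have disj: "disjoint_family_on (PiE {..<n}) ?Z"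
    unfolding disjoint_family_on_def
  proof (intro ballI impI)
    fix y z assume yz: "y \<in> ?Z" "z \<in> ?Z" "y \<noteq> z"
    then obtain i where i: "i < n" "y i \<noteq> z i"
      by (metis PiE_ext lessThan_iff)
    have "y i \<in> ?R" "z i \<in> ?R" using yz i by auto
    then have "y i \<inter> z i = {}"
      using K.rcos_disjoint[OF K.subgroup_axioms] i by (auto simp: pairwise_def disjnt_def)
    then show "PiE {..<n} y \<inter> PiE {..<n} z = {}" using i by (auto simp: PiE_iff)
  qed
  have meas: "measure \<nu> (\<Union>y\<in>W. PiE {..<n} y) = card W * measure \<nu> (PiE {..<n} (\<lambda>_. K))"
    if W: "W \<subseteq> ?Z" for W
  proof -
    have "measure \<nu> (\<Union>y\<in>W. PiE {..<n} y) = (\<Sum>y\<in>W. measure \<nu> (PiE {..<n} y))"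
      using W finZ box disj
      by (intro \<nu>.finite_measure_finite_Union) (auto intro: finite_subset disjoint_family_on_mono)
    also have "\<dots> = (\<Sum>y\<in>W. measure \<nu> (PiE {..<n} (\<lambda>_. K)))"
      using W eq by (intro sum.cong) auto
    finally show ?thesis by simp
  qed
  have "(\<Union>y\<in>?Z. PiE {..<n} y) = space \<nu>"
  proof (intro equalityI subsetI)
    fix x assume "x \<in> (\<Union>y\<in>?Z. PiE {..<n} y)"
    then obtain y where y: "y \<in> ?Z" "x \<in> PiE {..<n} y" by blast
    have "x i \<in> carrier G" if "i < n" for i
      using Rsub[of "y i"] y that by (auto simp: PiE_iff)
    then show "x \<in> space \<nu>" using y(2) unfolding space by (simp add: PiE_iff)
  next
    fix x assume x: "x \<in> space \<nu>"
    let ?y = "\<lambda>i\<in>{..<n}. K #>\<^bsub>G\<^esub> x i"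
    have "?y \<in> ?Z" using x unfolding space by (auto simp: PiE_iff RCOSETS_def)
    moreover have "x \<in> PiE {..<n} ?y"
      using x K.rcos_self[OF _ K.subgroup_axioms] unfolding space by (auto simp: PiE_iff)
    ultimately show "x \<in> (\<Union>y\<in>?Z. PiE {..<n} y)" by blast
  qed
  then have "card ?Z * measure \<nu> (PiE {..<n} (\<lambda>_. K)) = 1"
    using meas[of ?Z] \<nu>.prob_space by simp
  then show "measure \<nu> (\<Union>y\<in>Y. PiE {..<n} y) * card ?Z = card Y"
    using meas[OF Y] by (simp add: mult.assoc mult.commute)
  show "(\<Union>y\<in>Y. PiE {..<n} y) \<in> sets \<nu>"
    using Y finZ box by (intro sets.finite_UN) (auto intro: finite_subset)
qed

text \<open>A tuple that solves \<open>w = 1\<close> in \<open>G\<close> solves it modulo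
  \<open>K\<close>, so the solutions lie in a finite union of coset boxes; \<open>B\<close> is this
  measurable cover.\<close>

lemma eval_word_one_small_measure:
  fixes s :: nat
  assumes P: "profinite_group G T"
    and alt: "\<forall>N::nat. \<exists>k\<ge>N. \<exists>K. K \<lhd> G \<and> openin T K \<and> composition_factor (G Mod K) (alt_group k)"
    and \<nu>: "haar_measure (product_topology (\<lambda>_. T) {..<n}) (power_group n G) \<nu>"
    and w: "\<forall>(i, c)\<in>set w. i < n" "reduced_word w" "w \<noteq> []"
    and s: "2 \<le> s"
  shows "\<exists>B\<in>sets \<nu>. {x \<in> space \<nu>. eval_word G x w = \<one>\<^bsub>G\<^esub>} \<subseteq> B \<and> measure \<nu> B \<le> (length w)\<^sup>2 / s"
proof -
  have T: "topological_group G T" and cpt: "compact_space T"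
    using P by (auto simp: profinite_group_def)
  have G: "group G" and top: "topspace T = carrier G"
    using T by (auto simp: topological_group_def)
  \<comment> \<open>The degree is chosen after \<open>s\<close> and the word, which is what
    unbounded degrees allow.\<close>
  obtain k K where k: "2 * length w + 3 + s + (2 * s) ^ Suc (length w) \<le> k"
    and K: "K \<lhd> G" "openin T K" and c: "composition_factor (G Mod K) (alt_group k)"
    using alt by blast
  interpret K: normal K G by fact
  let ?H = "G Mod K"
  interpret H: group ?H by (rule K.factorgroup_is_group)
  have carr: "carrier ?H = rcosets\<^bsub>G\<^esub> K" by (simp add: FactGroup_def)
  let ?Z = "{..<n} \<rightarrow>\<^sub>E rcosets\<^bsub>G\<^esub> K"
  have fin: "finite (carrier ?H)"
    unfolding carr using finite_rcosets_open[OF T cpt K.subgroup_axioms K(2)] .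
  then have finZ: "finite ?Z" unfolding carr by (simp add: finite_PiE)
  define Y where "Y = {y \<in> ?Z. eval_word ?H y w = \<one>\<^bsub>?H\<^esub>}"
  define B where "B = (\<Union>y\<in>Y. PiE {..<n} y)"
  have YZ: "Y \<subseteq> ?Z" by (auto simp: Y_def)
  note box = measure_cosets_box[OF T cpt K \<nu> YZ, folded B_def]
  have count: "card Y * s \<le> (length w)\<^sup>2 * card ?Z"
    using H.card_eval_word_one_alt_factor[OF fin c w s k] unfolding Y_def carr .
  have "?Z \<noteq> {}" using K.subgroup_in_rcosets[OF G] by (auto simp: PiE_eq_empty_iff)
  then have Zpos: "0 < card ?Z" using finZ by (simp add: card_gt_0_iff)
  have "measure \<nu> B * card ?Z * s \<le> (length w)\<^sup>2 * card ?Z"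
    unfolding box(2) using count by (metis of_nat_le_iff of_nat_mult)
  then have "(measure \<nu> B * s) * card ?Z \<le> (length w)\<^sup>2 * card ?Z" by (simp add: ac_simps)
  then have "measure \<nu> B * s \<le> (length w)\<^sup>2" using Zpos by simp
  then have "measure \<nu> B \<le> (length w)\<^sup>2 / s" using s by (simp add: pos_le_divide_eq)
  moreover have "{x \<in> space \<nu>. eval_word G x w = \<one>\<^bsub>G\<^esub>} \<subseteq> B"
  proof safe
    fix x assume x: "x \<in> space \<nu>" and e: "eval_word G x w = \<one>\<^bsub>G\<^esub>"
    have "space \<nu> = ({..<n} \<rightarrow>\<^sub>E carrier G)" using \<nu> top by (simp add: haar_measure_def)
    then have xi: "x \<in> {..<n} \<rightarrow>\<^sub>E carrier G" using x by simp
    let ?y = "\<lambda>i\<in>{..<n}. K #>\<^bsub>G\<^esub> x i"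
    have "?y \<in> ?Z" using xi by (auto simp: PiE_iff RCOSETS_def)
    moreover have "eval_word ?H ?y w = K #>\<^bsub>G\<^esub> eval_word G x w"
      using w(1) xi by (intro K.eval_word_Mod) auto
    then have "eval_word ?H ?y w = \<one>\<^bsub>?H\<^esub>" using e K.coset_mult_one[OF K.subset] by simp
    ultimately have "?y \<in> Y" by (simp add: Y_def)
    moreover have "x \<in> PiE {..<n} ?y"
      using xi K.rcos_self[OF _ K.subgroup_axioms] by (auto simp: PiE_iff)
    ultimately show "x \<in> B" unfolding B_def by blast
  qed
  ultimately show ?thesis using box(1) by blast
qed

text \<open>Intersecting covers whose measures tend to 0 gives one measurable null set containing
  all solutions. The shift to \<open>s + 2\<close> makes the bound available for every natural
  \<open>s\<close>.\<close>

lemma AE_eval_word_neq_one: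
  assumes P: "profinite_group G T"
    and alt: "\<forall>N::nat. \<exists>k\<ge>N. \<exists>K. K \<lhd> G \<and> openin T K \<and> composition_factor (G Mod K) (alt_group k)"
    and \<nu>: "haar_measure (product_topology (\<lambda>_. T) {..<n}) (power_group n G) \<nu>"
    and w: "\<forall>(i, c)\<in>set w. i < n" "reduced_word w" "w \<noteq> []"
  shows "AE x in \<nu>. eval_word G x w \<noteq> \<one>\<^bsub>G\<^esub>"
proof -
  interpret \<nu>: prob_space \<nu> using \<nu> by (simp add: haar_measure_def)
  have "\<forall>s::nat. \<exists>B. B \<in> sets \<nu> \<and> {x \<in> space \<nu>. eval_word G x w = \<one>\<^bsub>G\<^esub>} \<subseteq> B \<and>
      measure \<nu> B \<le> (length w)\<^sup>2 / (real s + 2)"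
  proof
    fix s :: nat
    have "real (s + 2) = real s + 2" by simp
    then show "\<exists>B. B \<in> sets \<nu> \<and> {x \<in> space \<nu>. eval_word G x w = \<one>\<^bsub>G\<^esub>} \<subseteq> B \<and>
        measure \<nu> B \<le> (length w)\<^sup>2 / (real s + 2)"
      using eval_word_one_small_measure[OF P alt \<nu> w, of "s + 2"] by (simp only:) auto
  qed
  from choice[OF this] obtain B where B: "\<And>s::nat. B s \<in> sets \<nu>"
    "\<And>s. {x \<in> space \<nu>. eval_word G x w = \<one>\<^bsub>G\<^esub>} \<subseteq> B s"
    "\<And>s. measure \<nu> (B s) \<le> (length w)\<^sup>2 / (real s + 2)"
    by blast
  let ?B = "\<Inter>s. B s"
  have mB: "?B \<in> sets \<nu>" using B(1) by auto
  have "measure \<nu> ?B \<le> 0"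
  proof (rule LIMSEQ_le_const)
    show "(\<lambda>s. (length w)\<^sup>2 / (real s + 2)) \<longlonglongrightarrow> 0" by real_asymp
    have "measure \<nu> ?B \<le> (length w)\<^sup>2 / (real s + 2)" for s
    proof -
      have "measure \<nu> ?B \<le> measure \<nu> (B s)"
        using B(1) by (intro \<nu>.finite_measure_mono) auto
      also have "\<dots> \<le> (length w)\<^sup>2 / (real s + 2)" using B(3)[of s] by simp
      finally show ?thesis .
    qed
    then show "\<exists>N. \<forall>s\<ge>N. measure \<nu> ?B \<le> (length w)\<^sup>2 / (real s + 2)" by blast
  qed
  then have "emeasure \<nu> ?B = 0" by (simp add: \<nu>.emeasure_eq_measure measure_le_0_iff)
  moreover have "{x \<in> space \<nu>. \<not> eval_word G x w \<noteq> \<one>\<^bsub>G\<^esub>} \<subseteq> ?B" using B(2) by auto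
  ultimately show ?thesis using mB by (intro AE_I) auto
qed

theorem theorem7:
  fixes G :: "('a, 'b) monoid_scheme" and T :: "'a topology"
    and n :: nat and \<nu> :: "(nat \<Rightarrow> 'a) measure"
  assumes "profinite_group G T"
    and "\<forall>N::nat. \<exists>k\<ge>N. \<exists>K. K \<lhd> G \<and> openin T K \<and>
            composition_factor (G Mod K) (alt_group k)"
    and "n \<ge> 1"
    and "haar_measure (product_topology (\<lambda>_. T) {..<n}) (power_group n G) \<nu>"
  shows "AE x in \<nu>. freely_generates G n x"
proof -
  have "topspace T = carrier G"
    using assms(1) by (simp add: profinite_group_def topological_group_def)
  then have space: "space \<nu> = ({..<n} \<rightarrow>\<^sub>E carrier G)"
    using assms(4) by (simp add: haar_measure_def)
  have "AE x in \<nu>. \<forall>w. w \<noteq> [] \<and> reduced_word w \<and> (\<forall>(i, b)\<in>set w. i < n) \<longrightarrow>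
      eval_word G x w \<noteq> \<one>\<^bsub>G\<^esub>"
    unfolding AE_all_countable
  proof
    fix w
    show "AE x in \<nu>. w \<noteq> [] \<and> reduced_word w \<and> (\<forall>(i, b)\<in>set w. i < n) \<longrightarrow>
      eval_word G x w \<noteq> \<one>\<^bsub>G\<^esub>"
    proof (cases "w \<noteq> [] \<and> reduced_word w \<and> (\<forall>(i, b)\<in>set w. i < n)")
      case True
      then show ?thesis using AE_eval_word_neq_one[OF assms(1,2,4), of w] by simp
    next
      case False
      then show ?thesis by (intro AE_I2) blast
    qed
  qed
  then show ?thesis
    \<comment> \<open>Membership of the entries in \<open>carrier G\<close> comes from the
      underlying space.\<close>
    using AE_space
  proof eventually_elim
    case (elim x)
    then show ?case by (auto simp: freely_generates_def space)
  qed
qed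

end
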